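(* Let $\mathcal{Q}$ be a non-empty set of probability measures on a measurable space $(\Omega,\mathcal{F})$, with $\mathcal{H}$, $\mathbb{E}$, $\mathcal{E}$ and the lower capacity $v$ associated with $\mathcal{Q}$ as specified in the context. Suppose $\{X_i\}_{i=1}^{\infty}$ is a convolutionary sequence of identically distributed (real-valued) random variables on $(\Omega,\mathcal{H},\mathbb{E})$ satisfying $\mathbb{E}[X_1]=\mathcal{E}[X_1]=0$, $\mathbb{E}[X_1^2]=\overline{\sigma}^2$ and $\mathcal{E}[X_1^2]=\underline{\sigma}^2$, where $\overline\sigma,\underline\sigma\ge 0$. Let $S_n=\sum_{i=1}^n X_i$ and $a_n=\sqrt{2n\log\log n}$ (for $n\ge3$). Then $$v\left(-\overline{\sigma}\leq\liminf_{n\to\infty}\frac{S_n}{a_n}\leq\limsup_{n\to\infty}\frac{S_n}{a_n}\leq\overline{\sigma}\right)=1.$$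
   Context: Here $\mathbb{N}^+=\{1,2,\dots\}$. $C_{l,Lip}(\mathbb{R}^n)$ is the linear space of functions $\varphi:\mathbb{R}^n\to\mathbb{R}$ for which there are $C>0$ and $m\in\mathbb{N}$ with $|\varphi(x)-\varphi(y)|\le C(1+|x|^m+|y|^m)|x-y|$ for all $x,y\in\mathbb{R}^n$. Setting. $\mathcal{H}$ is a set of real random variables on $(\Omega,\mathcal{F})$ such that: $X_1,\dots,X_n\in\mathcal{H}$ implies $\varphi(X_1,\dots,X_n)\in\mathcal{H}$ for every $\varphi\in C_{l,Lip}(\mathbb{R}^n)$; $\mathcal{H}\subset\bigcap_{P\in\mathcal{Q}}L^1(\Omega,\mathcal{F},P)$; and if $X\in\mathcal{H}$ then the indicator $I_{\{X\in A\}}\in\mathcal{H}$ for every Borel set $A\in\mathcal{B}(\mathbb{R})$. For $X\in\mathcal{H}$, $$\mathbb{E}[X]:=\sup_{P\in\mathcal{Q}}E_P[X],\qquad \mathcal{E}[X]:=\inf_{P\in\mathcal{Q}}E_P[X]=-\mathbb{E}[-X],$$ and $\mathbb{E}$ is assumed to be real-valued on $\mathcal{H}$ (so that $(\Omega,\mathcal{H},\mathbb{E})$ is a sublinear expectation space, $\mathbb{E}:\mathcal{H}\to\mathbb{R}$ being monotone, constant preserving, sub-additive and positively homogeneous). The lower capacity is $v(A):=\inf_{P\in\mathcal{Q}}P(A)$ for $A\in\mathcal{F}$. Identical distribution. Random variables $X,Y\in\mathcal{H}$ are identically distributed if $\mathbb{E}[\varphi(X)]=\mathbb{E}[\varphi(Y)]$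 for every $\varphi\in C_{l,Lip}(\mathbb{R})$. Convolution. For $X,Y\in\mathcal{H}$, "$Y$ and $X$ are of convolution" means $\mathbb{E}[\varphi(X+Y)]=\mathbb{E}\big[\mathbb{E}[\varphi(x+Y)]_{x=X}\big]$ for every $\varphi\in C_{l,Lip}(\mathbb{R})$. A sequence $\{X_i\}_{i\ge1}$ is convolutionary if for all $n\in\mathbb{N}^+$ and $1\le k\le n$, with $S=\sum_{i=k}^{n}X_i$, one has $\mathbb{E}[\varphi(S+X_{n+1})]=\mathbb{E}\big[\mathbb{E}[\varphi(x+X_{n+1})]_{x=S}\big]$ for every $\varphi\in C_{l,Lip}(\mathbb{R})$. *)

theory Defs
  imports "HOL-Probability.Probability"
begin

definition C_lLip :: "(real \<Rightarrow> real) set" where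
  "C_lLip = {\<phi>. \<exists>C>0. \<exists>m::nat. \<forall>x y.
     \<bar>\<phi> x - \<phi> y\<bar> \<le> C * (1 + \<bar>x\<bar> ^ m + \<bar>y\<bar> ^ m) * \<bar>x - y\<bar>}"

text \<open>
  The same class on \<open>n\<close>-dimensional Euclidean space, for \<open>n\<close> ranging over the natural numbers.
  A vector is the restriction of \<open>x :: nat \<Rightarrow> real\<close> to \<open>{..<n}\<close>, with Euclidean norm
  \<open>L2_set x {..<n}\<close>. As \<open>x\<close> and \<open>y\<close> range over all functions, the inequality forces \<open>\<phi> x = \<phi> y\<close>
  whenever \<open>x\<close> and \<open>y\<close> agree on \<open>{..<n}\<close>, so the members of the set are exactly the functions
  of \<open>n\<close> real variables that satisfy the condition.
\<close>
definition C_lLip_dim :: "nat \<Rightarrow> ((nat \<Rightarrow> real) \<Rightarrow> real) set" where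
  "C_lLip_dim n = {\<phi>. \<exists>C>0. \<exists>m::nat. \<forall>x y.
     \<bar>\<phi> x - \<phi> y\<bar>
       \<le> C * (1 + L2_set x {..<n} ^ m + L2_set y {..<n} ^ m) * L2_set (\<lambda>i. x i - y i) {..<n}}"

lemma C_lLip_dim_cong:
  assumes "\<phi> \<in> C_lLip_dim n" and "\<And>i. i < n \<Longrightarrow> x i = y i"
  shows "\<phi> x = \<phi> y"
proof -
  obtain C and m :: nat where
    le: "\<bar>\<phi> x - \<phi> y\<bar>
       \<le> C * (1 + L2_set x {..<n} ^ m + L2_set y {..<n} ^ m) * L2_set (\<lambda>i. x i - y i) {..<n}"
    using assms(1) unfolding C_lLip_dim_def mem_Collect_eq by (elim exE conjE allE)
  have "L2_set (\<lambda>i. x i - y i) {..<n} = 0"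
    using assms(2) by (simp add: L2_set_def)
  with le show ?thesis by simp
qed

lemma C_lLip_dim_1: "(\<lambda>x. \<phi> (x 0)) \<in> C_lLip_dim 1 \<longleftrightarrow> \<phi> \<in> C_lLip"
proof
  have norm_1: "L2_set x {..<1} = \<bar>x 0\<bar>" for x :: "nat \<Rightarrow> real"
    by (simp add: L2_set_def lessThan_Suc)
  {
    assume "(\<lambda>x. \<phi> (x 0)) \<in> C_lLip_dim 1"
    then obtain C and m :: nat where "C > 0" and
      le: "\<forall>(x :: nat \<Rightarrow> real) (y :: nat \<Rightarrow> real).
        \<bar>\<phi> (x 0) - \<phi> (y 0)\<bar> \<le> C * (1 + \<bar>x 0\<bar> ^ m + \<bar>y 0\<bar> ^ m) * \<bar>x 0 - y 0\<bar>"
      unfolding C_lLip_dim_def norm_1 mem_Collect_eq by (elim exE conjE) (rule that)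
    have "\<bar>\<phi> x - \<phi> y\<bar> \<le> C * (1 + \<bar>x\<bar> ^ m + \<bar>y\<bar> ^ m) * \<bar>x - y\<bar>" for x y
      by (rule le[rule_format, of "\<lambda>_. x" "\<lambda>_. y"])
    with \<open>C > 0\<close> show "\<phi> \<in> C_lLip"
      unfolding C_lLip_def by blast
  next
    assume "\<phi> \<in> C_lLip"
    then show "(\<lambda>x. \<phi> (x 0)) \<in> C_lLip_dim 1"
      unfolding C_lLip_def C_lLip_dim_def norm_1 by blast
  }
qed

definition upper_expectation :: "'a measure set \<Rightarrow> ('a \<Rightarrow> real) \<Rightarrow> real" where
  "upper_expectation Q X = (SUP P\<in>Q. integral\<^sup>L P X)"

definition lower_expectation :: "'a measure set \<Rightarrow> ('a \<Rightarrow> real) \<Rightarrow> real" where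
  "lower_expectation Q X = (INF P\<in>Q. integral\<^sup>L P X)"

lemma lower_expectation_eq: "lower_expectation Q X = - upper_expectation Q (\<lambda>\<omega>. - X \<omega>)"
  by (simp add: lower_expectation_def upper_expectation_def Inf_real_def image_image)

definition lower_capacity :: "'a measure set \<Rightarrow> 'a set \<Rightarrow> real" where
  "lower_capacity Q A = (INF P\<in>Q. measure P A)"

text \<open>
  \<open>F\<close> serves only as a measurable space: its measure is not used. The assumption
  \<open>upper_bounded\<close> says that \<open>upper_expectation Q\<close> is real-valued on \<open>H\<close>; without it the real-valued
  supremum above would be an arbitrary number.
\<close>
locale sublinear_expectation_setting =
  fixes F :: "'a measure" and Q :: "'a measure set" and H :: "('a \<Rightarrow> real) set"
  assumes Q_nonempty: "Q \<noteq> {}"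
    and Q_prob_space: "\<And>P. P \<in> Q \<Longrightarrow> prob_space P"
    and Q_sets: "\<And>P. P \<in> Q \<Longrightarrow> sets P = sets F"
    and H_measurable: "H \<subseteq> borel_measurable F"
    and H_closed: "\<And>n X \<phi>. n \<ge> 1 \<Longrightarrow> (\<And>i. i < n \<Longrightarrow> X i \<in> H) \<Longrightarrow> \<phi> \<in> C_lLip_dim n
          \<Longrightarrow> (\<lambda>\<omega>. \<phi> (\<lambda>i. X i \<omega>)) \<in> H"
    and H_integrable: "\<And>X P. X \<in> H \<Longrightarrow> P \<in> Q \<Longrightarrow> integrable P X"
    and H_indicator: "\<And>X A. X \<in> H \<Longrightarrow> A \<in> sets borel \<Longrightarrow> (\<lambda>\<omega>. indicator A (X \<omega>)) \<in> H"
    and upper_bounded: "\<And>X. X \<in> H \<Longrightarrow> bdd_above ((\<lambda>P. integral\<^sup>L P X) ` Q)"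

definition identically_distributed :: "'a measure set \<Rightarrow> ('a \<Rightarrow> real) \<Rightarrow> ('a \<Rightarrow> real) \<Rightarrow> bool" where
  "identically_distributed Q X Y \<longleftrightarrow>
     (\<forall>\<phi>\<in>C_lLip. upper_expectation Q (\<lambda>\<omega>. \<phi> (X \<omega>)) = upper_expectation Q (\<lambda>\<omega>. \<phi> (Y \<omega>)))"

text \<open>\<open>of_convolution Q X Y\<close>: \<open>Y\<close> and \<open>X\<close> are of convolution, \<open>Y\<close> being integrated first.\<close>
definition of_convolution :: "'a measure set \<Rightarrow> ('a \<Rightarrow> real) \<Rightarrow> ('a \<Rightarrow> real) \<Rightarrow> bool" where
  "of_convolution Q X Y \<longleftrightarrow>
     (\<forall>\<phi>\<in>C_lLip. upper_expectation Q (\<lambda>\<omega>. \<phi> (X \<omega> + Y \<omega>)) =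
        upper_expectation Q (\<lambda>\<omega>. upper_expectation Q (\<lambda>\<omega>'. \<phi> (X \<omega> + Y \<omega>'))))"

text \<open>Sequences are indexed from 1; the value at index 0 is irrelevant.\<close>
definition convolutionary :: "'a measure set \<Rightarrow> (nat \<Rightarrow> 'a \<Rightarrow> real) \<Rightarrow> bool" where
  "convolutionary Q X \<longleftrightarrow>
     (\<forall>n\<ge>1. \<forall>k\<in>{1..n}. of_convolution Q (\<lambda>\<omega>. \<Sum>i=k..n. X i \<omega>) (X (n + 1)))"

end

theory Submission
  imports Defs "HOL-Real_Asymp.Real_Asymp"
begin

text \<open>
  It suffices to fix \<open>P\<close> in \<open>Q\<close> and \<open>s > \<sigma>_up\<close> and to show that \<open>P\<close>-almost surely
  \<open>\<bar>S n\<bar> \<le> s * a n\<close> for all large \<open>n\<close>. Under a single \<open>P\<close> the summands need not be independent,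
  centred given the past, or identically distributed; all information comes from upper expectations of
  functions of the block sums \<open>X (k + 1) + \<dots> + X (k + m)\<close>. For these the convolution property replaces
  conditioning: if the upper expectation of \<open>\<phi> (x + X 1)\<close> is bounded by an affine expression in
  \<open>\<phi> x\<close>, uniformly in \<open>x\<close>, then the upper expectations of \<open>\<phi>\<close> at the block sums satisfy the
  corresponding recursion (\<open>upper_expectation_block_Suc_le\<close>).

  This is applied to two kinds of test functions. For even powers it yields moments of order
  \<open>m ^ p\<close> for the \<open>2 p\<close>-th power of a block sum of length \<open>m\<close> (\<open>even_moment_bound\<close>). For an exponential
  that is continued quadratically beyond a level \<open>L\<close>, and hence is of polynomial growth, it
  yields the Gaussian tail bound (\<open>gaussian_tail\<close>)
  \<open>P (\<bar>S n\<bar> \<ge> r * a n) \<le> 4 * ln n powr (- r\<^sup>2 / V)\<close> for large \<open>n\<close> and every \<open>V > 0\<close> with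
  \<open>V \<ge> \<sigma>_up\<^sup>2\<close>. No truncation of the summands is involved: the level \<open>L\<close>
  needed in the Chebyshev inequality is of order \<open>ln (ln n)\<close>, so that the Taylor error, of order
  \<open>n powr (- 1 / 2)\<close> up to powers of \<open>ln n\<close>, stays negligible.

  From there on the argument concerns one probability measure (\<open>eventually_le_lil_scale\<close>). The tail bound is
  summable along times that grow slightly slower than geometrically. In the gaps between these times
  no independence is available for a sharp maximal inequality, but the gaps are short
  compared with the time itself, so that a maximal inequality derived from high moments of increments
  (\<open>dyadic_increment_envelope\<close>) is enough. The Borel--Cantelli lemma concludes.
\<close>

section \<open>Test functions of polynomial growth\<close>

text \<open>
  Differentiable functions whose derivative has polynomial growth satisfy the defining inequality,
  by the mean value theorem. All test functions below are recognised through this criterion.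
\<close>

lemma C_lLip_derivI:
  fixes f f' :: "real \<Rightarrow> real"
  assumes deriv: "\<And>x. (f has_real_derivative f' x) (at x)"
    and bound: "\<And>x. \<bar>f' x\<bar> \<le> C * (1 + \<bar>x\<bar> ^ m)"
  shows "f \<in> C_lLip"
proof -
  have "0 \<le> C * (1 + \<bar>1\<bar> ^ m)"
    using bound[of 1] by linarith
  then have "C \<ge> 0" by simp
  have "\<bar>f x - f y\<bar> \<le> (C + 1) * (1 + \<bar>x\<bar> ^ m + \<bar>y\<bar> ^ m) * \<bar>x - y\<bar>" for x y
  proof -
    have "norm (f x - f y) \<le> (C + 1) * (1 + \<bar>x\<bar> ^ m + \<bar>y\<bar> ^ m) * norm (x - y)"
    proof (rule field_differentiable_bound[where S = "closed_segment x y"])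
      fix z assume z: "z \<in> closed_segment x y"
      show "(f has_real_derivative f' z) (at z within closed_segment x y)"
        using deriv by (rule has_field_derivative_at_within)
      have "\<bar>z\<bar> \<le> max \<bar>x\<bar> \<bar>y\<bar>"
        using z unfolding closed_segment_eq_real_ivl by (auto split: if_splits)
      then have "\<bar>z\<bar> ^ m \<le> max \<bar>x\<bar> \<bar>y\<bar> ^ m"
        by (intro power_mono) auto
      also have "\<dots> \<le> \<bar>x\<bar> ^ m + \<bar>y\<bar> ^ m"
        by (simp add: max_def)
      finally have "C * (1 + \<bar>z\<bar> ^ m) \<le> (C + 1) * (1 + \<bar>x\<bar> ^ m + \<bar>y\<bar> ^ m)"
        using \<open>C \<ge> 0\<close> by (intro mult_mono) auto
      with bound[of z] show "norm (f' z) \<le> (C + 1) * (1 + \<bar>x\<bar> ^ m + \<bar>y\<bar> ^ m)"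
        by simp
    qed auto
    then show ?thesis by simp
  qed
  moreover have "C + 1 > 0" using \<open>C \<ge> 0\<close> by simp
  ultimately show ?thesis unfolding C_lLip_def by blast
qed

lemma C_lLip_power: "(\<lambda>x. x ^ n) \<in> C_lLip"
proof (rule C_lLip_derivI)
  show "((\<lambda>x. x ^ n) has_real_derivative real n * x ^ (n - 1)) (at x)" for x
    by (auto intro!: derivative_eq_intros)
  show "\<bar>real n * x ^ (n - 1)\<bar> \<le> real n * (1 + \<bar>x\<bar> ^ (n - 1))" for x
    by (simp add: abs_mult power_abs algebra_simps)
qed

lemma C_lLip_const: "(\<lambda>x. c) \<in> C_lLip"
  by (rule C_lLip_derivI[where f' = "\<lambda>_. 0" and C = 0 and m = 0]) auto

lemma C_lLip_square_plus_fourth: "(\<lambda>x. x\<^sup>2 + x ^ 4) \<in> C_lLip"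
proof (rule C_lLip_derivI)
  show "((\<lambda>x. x\<^sup>2 + x ^ 4) has_real_derivative 2 * x + 4 * x ^ 3) (at x)" for x
    by (auto intro!: derivative_eq_intros)
  show "\<bar>2 * x + 4 * x ^ 3\<bar> \<le> 6 * (1 + \<bar>x\<bar> ^ 3)" for x :: real
  proof -
    have "\<bar>x\<bar> \<le> 1 + \<bar>x\<bar> ^ 3"
    proof (cases "\<bar>x\<bar> \<le> 1")
      case False
      then show ?thesis using power_increasing[of 1 3 "\<bar>x\<bar>"] by simp
    qed (simp add: add_increasing2)
    moreover have "\<bar>2 * x + 4 * x ^ 3\<bar> \<le> 2 * \<bar>x\<bar> + 4 * \<bar>x\<bar> ^ 3"
      using abs_triangle_ineq[of "2 * x" "4 * x ^ 3"] by (simp add: abs_mult power_abs)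
    ultimately show ?thesis by (simp add: algebra_simps)
  qed
qed

text \<open>
  Shifts of test functions are needed because the convolution property integrates
  \<open>y \<mapsto> \<phi> (x + y)\<close>, and only test functions transfer between identically distributed variables.
\<close>

lemma C_lLip_shift:
  assumes "f \<in> C_lLip"
  shows "(\<lambda>y. f (x + y)) \<in> C_lLip"
proof -
  obtain C :: real and m :: nat where C: "C > 0"
    "\<And>x y. \<bar>f x - f y\<bar> \<le> C * (1 + \<bar>x\<bar> ^ m + \<bar>y\<bar> ^ m) * \<bar>x - y\<bar>"
    using assms unfolding C_lLip_def by blast
  define K where "K = 2 ^ m * (2 * \<bar>x\<bar> ^ m + 1)"
  have "K \<ge> 0" by (simp add: K_def)
  have pow: "\<bar>x + u\<bar> ^ m \<le> 2 ^ m * (\<bar>x\<bar> ^ m + \<bar>u\<bar> ^ m)" for u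
  proof -
    have "\<bar>x + u\<bar> ^ m \<le> (2 * max \<bar>x\<bar> \<bar>u\<bar>) ^ m"
      by (intro power_mono) auto
    also have "\<dots> \<le> 2 ^ m * (\<bar>x\<bar> ^ m + \<bar>u\<bar> ^ m)"
      by (simp add: max_def power_mult_distrib)
    finally show ?thesis .
  qed
  have "\<bar>f (x + u) - f (x + v)\<bar> \<le> (C * (1 + K)) * (1 + \<bar>u\<bar> ^ m + \<bar>v\<bar> ^ m) * \<bar>u - v\<bar>" for u v
  proof -
    have "1 + \<bar>x + u\<bar> ^ m + \<bar>x + v\<bar> ^ m
        \<le> 1 + 2 ^ m * (2 * \<bar>x\<bar> ^ m + \<bar>u\<bar> ^ m + \<bar>v\<bar> ^ m)"
      using pow[of u] pow[of v] by (simp add: algebra_simps)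
    also have "\<dots> \<le> 1 + K * (1 + \<bar>u\<bar> ^ m + \<bar>v\<bar> ^ m)"
      unfolding K_def by (simp add: algebra_simps)
    also have "\<dots> \<le> (1 + K) * (1 + \<bar>u\<bar> ^ m + \<bar>v\<bar> ^ m)"
      by (simp add: algebra_simps)
    finally have "C * (1 + \<bar>x + u\<bar> ^ m + \<bar>x + v\<bar> ^ m)
        \<le> C * ((1 + K) * (1 + \<bar>u\<bar> ^ m + \<bar>v\<bar> ^ m))"
      using C(1) by (intro mult_left_mono) auto
    then have "C * (1 + \<bar>x + u\<bar> ^ m + \<bar>x + v\<bar> ^ m) * \<bar>u - v\<bar>
        \<le> C * ((1 + K) * (1 + \<bar>u\<bar> ^ m + \<bar>v\<bar> ^ m)) * \<bar>u - v\<bar>"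
      by (intro mult_right_mono) auto
    with C(2)[of "x + u" "x + v"] show ?thesis by (simp add: mult.assoc)
  qed
  moreover have "C * (1 + K) > 0" using C(1) \<open>K \<ge> 0\<close> by simp
  ultimately show ?thesis unfolding C_lLip_def by blast
qed

section \<open>Second order expansions\<close>

lemma second_order_expansion:
  fixes f f' f'' :: "real \<Rightarrow> real"
  assumes "\<And>x. (f has_real_derivative f' x) (at x)"
    and "\<And>x. (f' has_real_derivative f'' x) (at x)"
  obtains \<xi> where "\<bar>\<xi> - x\<bar> \<le> \<bar>h\<bar>" "f (x + h) = f x + f' x * h + f'' \<xi> / 2 * h\<^sup>2"
proof (cases "h = 0")
  case True
  then show ?thesis using that[of x] by simp
next
  case False
  define diff where "diff n = (if n = 0 then f else if n = 1 then f' else f'')" for n :: nat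
  have "\<exists>t. (if x + h < x then x + h < t \<and> t < x else x < t \<and> t < x + h) \<and>
    f (x + h) = (\<Sum>m<2. (diff m x / fact m) * ((x + h) - x)^m) + (diff 2 t / fact 2) * ((x + h) - x)^2"
    by (rule Taylor[where a = "min x (x + h)" and b = "max x (x + h)"])
       (use False assms in \<open>auto simp: diff_def less_2_cases_iff\<close>)
  then obtain t where "if x + h < x then x + h < t \<and> t < x else x < t \<and> t < x + h"
    "f (x + h) = (\<Sum>m<2. (diff m x / fact m) * ((x + h) - x)^m) + (diff 2 t / fact 2) * ((x + h) - x)^2"
    by blast
  then show ?thesis
    by (intro that[of t]) (auto simp: diff_def numeral_2_eq_2 split: if_splits)
qed

lemma has_real_derivative_glue:
  fixes f g :: "real \<Rightarrow> real"
  assumes f: "\<And>x. (f has_real_derivative f' x) (at x)"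
    and g: "\<And>x. (g has_real_derivative g' x) (at x)"
    and eq: "f L = g L" "f' L = g' L"
  shows "((\<lambda>x. if x \<le> L then f x else g x) has_real_derivative (if x \<le> L then f' x else g' x)) (at x)"
    (is "(?h has_real_derivative ?h' x) _")
proof -
  have "((\<lambda>x. if x \<in> {..L} then f x else g x) has_vector_derivative
      (if x \<in> {..L} then f' x else g' x)) (at x within UNIV)"
  proof (rule has_vector_derivative_If_within_closures[where T = "{L<..}"])
    show "(f has_vector_derivative f' x) (at x within A)"
      "(g has_vector_derivative g' x) (at x within A)" for A
      using f g by (auto simp: has_real_derivative_iff_has_vector_derivative
          intro: has_vector_derivative_at_within)
  qed (use eq in \<open>auto split: if_splits\<close>)
  then show ?thesis
    by (simp add: has_real_derivative_iff_has_vector_derivative)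
qed

section \<open>The capped exponential\<close>

text \<open>
  The variables have all moments, but exponential moments may be infinite, and \<open>exp\<close> has too fast
  growth for a test function. Beyond the level \<open>L\<close> it is therefore continued by its second order Taylor
  polynomial at \<open>L\<close>. The result is twice continuously differentiable, its second derivative
  \<open>exp (min y L)\<close> lies below the function itself and has Lipschitz constant \<open>exp L\<close>, and it still
  dominates \<open>exp L\<close> on \<open>{L..}\<close>, which is all that the exponential Chebyshev inequality at
  level \<open>L\<close> uses.
\<close>

definition capped_exp :: "real \<Rightarrow> real \<Rightarrow> real" where
  "capped_exp L y = (if y \<le> L then exp y else exp L * (1 + (y - L) + (y - L)\<^sup>2 / 2))"

definition capped_exp' :: "real \<Rightarrow> real \<Rightarrow> real" where
  "capped_exp' L y = (if y \<le> L then exp y else exp L * (1 + (y - L)))"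

lemma capped_exp_deriv: "(capped_exp L has_real_derivative capped_exp' L y) (at y)"
  unfolding capped_exp_def[abs_def] capped_exp'_def
  by (rule has_real_derivative_glue) (auto intro!: derivative_eq_intros simp: field_simps)

lemma capped_exp'_deriv: "(capped_exp' L has_real_derivative exp (min y L)) (at y)"
proof -
  have "(capped_exp' L has_real_derivative (if y \<le> L then exp y else exp L)) (at y)"
    unfolding capped_exp'_def[abs_def]
    by (rule has_real_derivative_glue) (auto intro!: derivative_eq_intros)
  then show ?thesis by (cases "y \<le> L") (simp_all add: min_def)
qed

lemma exp_min_le_capped_exp: "exp (min y L) \<le> capped_exp L y"
proof (cases "y \<le> L")
  case False
  then have "1 \<le> 1 + (y - L) + (y - L)\<^sup>2 / 2"
    using zero_le_power2[of "y - L"] by linarith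
  then show ?thesis using False by (simp add: capped_exp_def)
qed (simp add: capped_exp_def)

lemma capped_exp_nonneg: "capped_exp L y \<ge> 0"
  using exp_min_le_capped_exp[of y L] exp_gt_zero[of "min y L"] by linarith

lemma capped_exp_ge: "L \<le> y \<Longrightarrow> exp L \<le> capped_exp L y"
  using exp_min_le_capped_exp[of y L] by (simp add: min_def split: if_splits)

lemma exp_min_Lipschitz:
  fixes y z L :: real
  shows "\<bar>exp (min y L) - exp (min z L)\<bar> \<le> exp L * \<bar>y - z\<bar>"
proof -
  have *: "exp v - exp u \<le> exp L * (v - u)" if "u \<le> v" "v \<le> L" for u v :: real
  proof -
    have "exp v - exp u = exp v * (1 - exp (u - v))"
      by (simp add: exp_diff field_simps)
    also have "\<dots> \<le> exp v * (v - u)"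
      using exp_ge_add_one_self[of "u - v"] by (intro mult_left_mono) (linarith, simp)
    also have "\<dots> \<le> exp L * (v - u)"
      using that by (intro mult_right_mono) auto
    finally show ?thesis .
  qed
  have **: "\<bar>exp (min y L) - exp (min z L)\<bar> \<le> exp L * \<bar>y - z\<bar>" if "z \<le> y" for y z
  proof -
    have "\<bar>exp (min y L) - exp (min z L)\<bar> = exp (min y L) - exp (min z L)"
      using that by simp
    also have "\<dots> \<le> exp L * (min y L - min z L)"
      by (rule *) (use that in auto)
    also have "\<dots> \<le> exp L * \<bar>y - z\<bar>"
      using that by (intro mult_left_mono) auto
    finally show ?thesis .
  qed
  show ?thesis
    using **[of z y] **[of y z] by (cases "z \<le> y") (auto simp: abs_minus_commute)
qed

lemma C_lLip_capped_exp: "(\<lambda>x. capped_exp L (l * x)) \<in> C_lLip"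
proof (rule C_lLip_derivI)
  show "((\<lambda>x. capped_exp L (l * x)) has_real_derivative capped_exp' L (l * x) * l) (at x)" for x
    by (rule DERIV_chain'[OF _ capped_exp_deriv, THEN DERIV_cong])
       (auto intro!: derivative_eq_intros)
  show "\<bar>capped_exp' L (l * x) * l\<bar> \<le> exp L * (1 + \<bar>l\<bar> + \<bar>L\<bar>) * \<bar>l\<bar> * (1 + \<bar>x\<bar> ^ 1)" for x
  proof -
    have "\<bar>capped_exp' L y\<bar> \<le> exp L * (1 + \<bar>L\<bar> + \<bar>y\<bar>)" for y
    proof (cases "y \<le> L")
      case True
      then have "exp y \<le> exp L * 1" by simp
      also have "\<dots> \<le> exp L * (1 + \<bar>L\<bar> + \<bar>y\<bar>)"
        by (intro mult_left_mono) auto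
      finally show ?thesis using True by (simp add: capped_exp'_def)
    qed (auto simp: capped_exp'_def abs_mult intro!: mult_left_mono)
    from this[of "l * x"] have "\<bar>capped_exp' L (l * x)\<bar> \<le> exp L * (1 + \<bar>L\<bar> + \<bar>l\<bar> * \<bar>x\<bar>)"
      by (simp add: abs_mult)
    also have "\<dots> \<le> exp L * ((1 + \<bar>l\<bar> + \<bar>L\<bar>) * (1 + \<bar>x\<bar>))"
      by (intro mult_left_mono) (auto simp: algebra_simps)
    finally have "\<bar>capped_exp' L (l * x)\<bar> * \<bar>l\<bar> \<le> exp L * ((1 + \<bar>l\<bar> + \<bar>L\<bar>) * (1 + \<bar>x\<bar>)) * \<bar>l\<bar>"
      by (rule mult_right_mono) simp
    then show ?thesis by (simp add: abs_mult ac_simps)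
  qed
qed

text \<open>
  Since the second derivative is dominated by the function, the quadratic term is the one that the
  exponential itself would give. The Lipschitz constant of the second derivative controls the error
  by \<open>\<bar>h\<bar>\<^sup>3\<close>, which is replaced by even powers so as to have a smooth test function.
\<close>

lemma capped_exp_expansion:
  "capped_exp L (l * (x + h)) \<le> capped_exp L (l * x) + capped_exp' L (l * x) * l * h
     + capped_exp L (l * x) * l\<^sup>2 / 2 * h\<^sup>2 + exp L * \<bar>l\<bar> ^ 3 * (h\<^sup>2 + h ^ 4)"
proof -
  let ?y = "l * x" and ?k = "l * h"
  obtain \<xi> where \<xi>: "\<bar>\<xi> - ?y\<bar> \<le> \<bar>?k\<bar>"
    "capped_exp L (?y + ?k) = capped_exp L ?y + capped_exp' L ?y * ?k + exp (min \<xi> L) / 2 * ?k\<^sup>2"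
    using second_order_expansion[OF capped_exp_deriv capped_exp'_deriv] by blast
  have "exp (min \<xi> L) \<le> exp (min ?y L) + exp L * \<bar>\<xi> - ?y\<bar>"
    using exp_min_Lipschitz[of \<xi> L ?y] by linarith
  also have "\<dots> \<le> capped_exp L ?y + exp L * \<bar>?k\<bar>"
    using \<xi>(1) by (intro add_mono mult_left_mono exp_min_le_capped_exp) auto
  finally have "exp (min \<xi> L) / 2 * ?k\<^sup>2 \<le> (capped_exp L ?y + exp L * \<bar>?k\<bar>) / 2 * ?k\<^sup>2"
    by (intro mult_right_mono divide_right_mono) auto
  also have "\<dots> = capped_exp L ?y * l\<^sup>2 / 2 * h\<^sup>2 + exp L / 2 * (\<bar>?k\<bar> * ?k\<^sup>2)"
    by (simp add: power_mult_distrib algebra_simps add_divide_distrib)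
  also have "\<bar>?k\<bar> * ?k\<^sup>2 = \<bar>?k\<bar> ^ 3"
    unfolding power2_abs[of ?k, symmetric] by (simp only: power2_eq_square power3_eq_cube mult.assoc)
  also have "exp L / 2 * \<bar>?k\<bar> ^ 3 = exp L * \<bar>l\<bar> ^ 3 * (\<bar>h\<bar> ^ 3 / 2)"
    by (simp add: abs_mult power_mult_distrib)
  also have "\<bar>h\<bar> ^ 3 / 2 \<le> h\<^sup>2 + h ^ 4"
  proof -
    have cube: "a ^ 3 / 2 \<le> a\<^sup>2 + a ^ 4" if "a \<ge> 0" for a :: real
    proof -
      have "a\<^sup>2 + a ^ 4 - a ^ 3 / 2 = a\<^sup>2 * ((a - 1 / 4)\<^sup>2 + 15 / 16)"
        by (simp add: power2_eq_square power3_eq_cube power4_eq_xxxx algebra_simps)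
      also have "\<dots> \<ge> 0" by (intro mult_nonneg_nonneg add_nonneg_nonneg) auto
      finally show ?thesis by simp
    qed
    show ?thesis using cube[of "\<bar>h\<bar>"] by (simp add: power_even_abs)
  qed
  finally show ?thesis
    using \<xi>(2) by (simp add: distrib_left mult.assoc mult_left_mono del: distrib_left_numeral)
qed

text \<open>
  The \<open>2 p\<close>-th moment of a sum grows, per summand, by terms of order \<open>2 p - 2\<close> and a constant once
  the linear term has been integrated away. The constant \<open>c\<close> is crude; only its independence of \<open>x\<close>
  and \<open>h\<close> matters.
\<close>

lemma even_power_expansion:
  fixes x h :: real
  assumes "p \<ge> 1"
  defines "c \<equiv> real (2 * p) * real (2 * p - 1) * 2 ^ (2 * p - 2)"
  shows "(x + h) ^ (2 * p) \<le> x ^ (2 * p) + real (2 * p) * x ^ (2 * p - 1) * h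
     + c * x ^ (2 * p - 2) * h\<^sup>2 + c * h ^ (2 * p)"
proof -
  obtain \<xi> where \<xi>: "\<bar>\<xi> - x\<bar> \<le> \<bar>h\<bar>"
    "(x + h) ^ (2 * p) = x ^ (2 * p) + real (2 * p) * x ^ (2 * p - 1) * h
       + real (2 * p) * (real (2 * p - 1) * \<xi> ^ (2 * p - 2)) / 2 * h\<^sup>2"
  proof (rule second_order_expansion)
    show "((\<lambda>x. x ^ (2 * p)) has_real_derivative real (2 * p) * x ^ (2 * p - 1)) (at x)" for x
      by (rule DERIV_pow[folded One_nat_def])
    show "((\<lambda>x. real (2 * p) * x ^ (2 * p - 1)) has_real_derivative
        real (2 * p) * (real (2 * p - 1) * x ^ (2 * p - 2))) (at x)" for x
    proof -
      have "((\<lambda>x. x ^ (2 * p - 1)) has_real_derivative real (2 * p - 1) * x ^ (2 * p - 1 - 1)) (at x)"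
        by (rule DERIV_pow[folded One_nat_def])
      moreover have "2 * p - 1 - 1 = 2 * p - 2" by simp
      ultimately show ?thesis by (metis DERIV_cmult)
    qed
  qed blast
  have "even (2 * p - 2)" by simp
  have "\<xi> ^ (2 * p - 2) = \<bar>\<xi>\<bar> ^ (2 * p - 2)"
    using \<open>even (2 * p - 2)\<close> by (simp add: power_even_abs)
  also have "\<dots> \<le> (2 * max \<bar>x\<bar> \<bar>h\<bar>) ^ (2 * p - 2)"
    using \<xi>(1) by (intro power_mono) auto
  also have "\<dots> \<le> 2 ^ (2 * p - 2) * (\<bar>x\<bar> ^ (2 * p - 2) + \<bar>h\<bar> ^ (2 * p - 2))"
    by (simp add: max_def power_mult_distrib)
  also have "\<dots> = 2 ^ (2 * p - 2) * (x ^ (2 * p - 2) + h ^ (2 * p - 2))"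
    using \<open>even (2 * p - 2)\<close> by (simp add: power_even_abs)
  finally have "real (2 * p) * (real (2 * p - 1) * \<xi> ^ (2 * p - 2)) * h\<^sup>2
      \<le> real (2 * p) * (real (2 * p - 1) * (2 ^ (2 * p - 2) * (x ^ (2 * p - 2) + h ^ (2 * p - 2)))) * h\<^sup>2"
    by (intro mult_left_mono mult_right_mono) auto
  also have "\<dots> = c * x ^ (2 * p - 2) * h\<^sup>2 + c * (h ^ (2 * p - 2) * h\<^sup>2)"
    unfolding c_def by algebra
  also have "h ^ (2 * p - 2) * h\<^sup>2 = h ^ (2 * p)"
  proof -
    have "h ^ (2 * p - 2) * h\<^sup>2 = h ^ (2 * p - 2 + 2)"
      by (simp only: power_add)
    also have "2 * p - 2 + 2 = 2 * p"
      using \<open>p \<ge> 1\<close> by simp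
    finally show ?thesis .
  qed
  finally have "real (2 * p) * (real (2 * p - 1) * \<xi> ^ (2 * p - 2)) * h\<^sup>2
      \<le> c * x ^ (2 * p - 2) * h\<^sup>2 + c * h ^ (2 * p)" .
  moreover have "0 \<le> real (2 * p) * (real (2 * p - 1) * \<xi> ^ (2 * p - 2)) * h\<^sup>2"
    using \<open>even (2 * p - 2)\<close> by (simp add: zero_le_even_power)
  moreover have "real (2 * p) * (real (2 * p - 1) * \<xi> ^ (2 * p - 2)) / 2 * h\<^sup>2
      = real (2 * p) * (real (2 * p - 1) * \<xi> ^ (2 * p - 2)) * h\<^sup>2 / 2"
    by (simp only: times_divide_eq_left)
  ultimately show ?thesis
    using \<xi>(2) by linarith
qed

section \<open>A maximal inequality from moments of increments\<close>

text \<open>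
  The constant \<open>3 / 2\<close> leaves room in the halving argument below: doubling the length of a block
  doubles the number of sub-blocks, and \<open>2 * (3 / 2) < 2\<^sup>2\<close>.
\<close>

lemma power_add_le_weighted:
  assumes "p > 0"
  obtains c :: real where "c \<ge> 0"
    "\<And>x y :: real. x \<ge> 0 \<Longrightarrow> y \<ge> 0 \<Longrightarrow> (x + y) ^ p \<le> 3 / 2 * x ^ p + c * y ^ p"
proof -
  \<comment> \<open>If \<open>y\<close> is small compared with \<open>x\<close> then \<open>x + y \<le> t * x\<close>; otherwise \<open>x\<close> is bounded by a
    multiple of \<open>y\<close>.\<close>
  define t where "t = root p (3 / 2)"
  have t: "t > 1" "t ^ p = 3 / 2"
    using assms by (auto simp: t_def real_root_gt_1_iff)
  define c where "c = (1 + 1 / (t - 1)) ^ p"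
  have "(x + y) ^ p \<le> 3 / 2 * x ^ p + c * y ^ p" if "x \<ge> 0" "y \<ge> 0" for x y :: real
  proof (cases "y \<le> (t - 1) * x")
    case True
    then have "(x + y) ^ p \<le> (t * x) ^ p"
      using that by (intro power_mono) (auto simp: algebra_simps)
    also have "\<dots> = 3 / 2 * x ^ p" by (simp add: power_mult_distrib t)
    finally show ?thesis
      using that t by (simp add: c_def add_increasing2)
  next
    case False
    then have "x \<le> y / (t - 1)"
      using t by (simp add: field_simps)
    then have "(x + y) ^ p \<le> ((1 + 1 / (t - 1)) * y) ^ p"
      using that by (intro power_mono) (auto simp: algebra_simps)
    also have "\<dots> = c * y ^ p" by (simp add: power_mult_distrib c_def)
    finally show ?thesis
      using that by (simp add: add_increasing)
  qed
  moreover have "c \<ge> 0" using t by (simp add: c_def)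
  ultimately show ?thesis using that by blast
qed

text \<open>
  A maximal inequality that uses only the moments of the increments, neither independence nor a
  martingale property. The integrable envelope \<open>B\<close> stands for the maximum over \<open>j\<close>. In a block of
  length \<open>2 ^ Suc r\<close> an increment either stays within the first half or is the increment over
  the first half plus one within the second half. The envelopes of both halves enter with weight
  \<open>3 / 2\<close>, so that for \<open>q \<ge> 2\<close> the integral grows by at most the factor \<open>2 ^ q\<close> required.
\<close>

lemma dyadic_increment_envelope:
  fixes S :: "nat \<Rightarrow> 'a \<Rightarrow> real"
  assumes "q \<ge> 2"
    and int: "\<And>k m. integrable M (\<lambda>\<omega>. (S (k + m) \<omega> - S k \<omega>) ^ (2 * q))"
    and moment: "\<And>k m. (\<integral>\<omega>. (S (k + m) \<omega> - S k \<omega>) ^ (2 * q) \<partial>M) \<le> C * real m ^ q"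
  obtains K where "K \<ge> 0"
    "\<And>k r. \<exists>B. integrable M B \<and> (\<forall>\<omega>. \<forall>j\<le>2 ^ r. (S (k + j) \<omega> - S k \<omega>) ^ (2 * q) \<le> B \<omega>) \<and>
       integral\<^sup>L M B \<le> K * (2 ^ r) ^ q"
proof -
  obtain c :: real where c: "c \<ge> 0"
    "\<And>x y :: real. x \<ge> 0 \<Longrightarrow> y \<ge> 0 \<Longrightarrow> (x + y) ^ (2 * q) \<le> 3 / 2 * x ^ (2 * q) + c * y ^ (2 * q)"
    using power_add_le_weighted[of "2 * q"] \<open>q \<ge> 2\<close> by auto
  define K where "K = (1 + c) * C"
  have "0 \<le> (\<integral>\<omega>. (S (0 + 1) \<omega> - S 0 \<omega>) ^ (2 * q) \<partial>M)"
    by (intro integral_nonneg_AE) (simp add: zero_le_even_power)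
  also have "\<dots> \<le> C * real 1 ^ q" by (rule moment)
  finally have "C \<ge> 0" by simp
  then have K: "K \<ge> 0" "C \<le> K" "c * C \<le> K"
    using c by (auto simp: K_def algebra_simps)
  have "\<exists>B. integrable M B \<and> (\<forall>\<omega>. \<forall>j\<le>2 ^ r. (S (k + j) \<omega> - S k \<omega>) ^ (2 * q) \<le> B \<omega>) \<and>
       integral\<^sup>L M B \<le> K * (2 ^ r) ^ q" for k r
  proof (induction r arbitrary: k)
    case 0
    have "\<forall>\<omega>. \<forall>j\<le>2 ^ 0. (S (k + j) \<omega> - S k \<omega>) ^ (2 * q) \<le> (S (k + 1) \<omega> - S k \<omega>) ^ (2 * q)"
    proof (intro allI impI)
      fix \<omega> and j :: nat assume "j \<le> 2 ^ 0"
      then have "j = 0 \<or> j = 1" by auto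
      then show "(S (k + j) \<omega> - S k \<omega>) ^ (2 * q) \<le> (S (k + 1) \<omega> - S k \<omega>) ^ (2 * q)"
        using \<open>q \<ge> 2\<close> by (auto simp: zero_le_even_power zero_power)
    qed
    then show ?case
      using int[of k 1] moment[of k 1] K
      by (intro exI[of _ "\<lambda>\<omega>. (S (k + 1) \<omega> - S k \<omega>) ^ (2 * q)"]) auto
  next
    case (Suc r)
    obtain B1 where B1: "integrable M B1"
      "\<And>\<omega> j. j \<le> 2 ^ r \<Longrightarrow> (S (k + j) \<omega> - S k \<omega>) ^ (2 * q) \<le> B1 \<omega>"
      "integral\<^sup>L M B1 \<le> K * (2 ^ r) ^ q"
      using Suc[of k] by blast
    obtain B2 where B2: "integrable M B2"
      "\<And>\<omega> j. j \<le> 2 ^ r \<Longrightarrow> (S (k + 2 ^ r + j) \<omega> - S (k + 2 ^ r) \<omega>) ^ (2 * q) \<le> B2 \<omega>"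
      "integral\<^sup>L M B2 \<le> K * (2 ^ r) ^ q"
      using Suc[of "k + 2 ^ r"] by blast
    define D where "D \<omega> = (S (k + 2 ^ r) \<omega> - S k \<omega>) ^ (2 * q)" for \<omega>
    define B where "B \<omega> = 3 / 2 * (B1 \<omega> + B2 \<omega>) + c * D \<omega>" for \<omega>
    have D: "integrable M D" "integral\<^sup>L M D \<le> C * (2 ^ r) ^ q" "\<And>\<omega>. D \<omega> \<ge> 0"
      using int[of k "2 ^ r"] moment[of k "2 ^ r"] by (auto simp: D_def[abs_def] zero_le_even_power)
    have nonneg: "B1 \<omega> \<ge> 0" "B2 \<omega> \<ge> 0" for \<omega>
      using B1(2)[of 0 \<omega>] B2(2)[of 0 \<omega>] \<open>q \<ge> 2\<close> by (auto simp: zero_power)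
    have "(S (k + j) \<omega> - S k \<omega>) ^ (2 * q) \<le> B \<omega>" if j: "j \<le> 2 ^ Suc r" for \<omega> j
    proof (cases "j \<le> 2 ^ r")
      case True
      then have "(S (k + j) \<omega> - S k \<omega>) ^ (2 * q) \<le> B1 \<omega>" by (rule B1)
      also have "B1 \<omega> \<le> 3 / 2 * (B1 \<omega> + B2 \<omega>)"
        using nonneg[of \<omega>] by simp
      also have "\<dots> \<le> B \<omega>"
        using c D by (simp add: B_def)
      finally show ?thesis .
    next
      case False
      define i where "i = j - 2 ^ r"
      have i: "i \<le> 2 ^ r" "k + j = k + 2 ^ r + i"
        using j False by (auto simp: i_def)
      define x where "x = S (k + 2 ^ r + i) \<omega> - S (k + 2 ^ r) \<omega>"
      define y where "y = S (k + 2 ^ r) \<omega> - S k \<omega>"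
      have "(S (k + j) \<omega> - S k \<omega>) ^ (2 * q) = \<bar>x + y\<bar> ^ (2 * q)"
        by (simp add: i x_def y_def power_even_abs)
      also have "\<dots> \<le> (\<bar>x\<bar> + \<bar>y\<bar>) ^ (2 * q)"
        by (intro power_mono) auto
      also have "\<dots> \<le> 3 / 2 * \<bar>x\<bar> ^ (2 * q) + c * \<bar>y\<bar> ^ (2 * q)"
        by (rule c) auto
      also have "\<dots> = 3 / 2 * x ^ (2 * q) + c * D \<omega>"
        by (simp add: D_def y_def power_even_abs)
      also have "\<dots> \<le> 3 / 2 * B2 \<omega> + c * D \<omega>"
        using B2(2)[OF i(1), of \<omega>] by (simp add: x_def)
      also have "\<dots> \<le> B \<omega>"
        using nonneg[of \<omega>] by (simp add: B_def)
      finally show ?thesis .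
    qed
    moreover have "integrable M B"
      unfolding B_def using B1 B2 D by auto
    moreover have "integral\<^sup>L M B \<le> K * (2 ^ Suc r) ^ q"
    proof -
      have "integral\<^sup>L M B = 3 / 2 * (integral\<^sup>L M B1 + integral\<^sup>L M B2) + c * integral\<^sup>L M D"
        unfolding B_def using B1 B2 D by simp
      also have "\<dots> \<le> 3 / 2 * (K * (2 ^ r) ^ q + K * (2 ^ r) ^ q) + c * (C * (2 ^ r) ^ q)"
        using B1 B2 D c by (intro add_mono mult_left_mono) auto
      also have "\<dots> = (3 * K + c * C) * (2 ^ r) ^ q"
        by (simp add: algebra_simps)
      also have "\<dots> \<le> (2\<^sup>2 * K) * (2 ^ r) ^ q"
        using K by (intro mult_right_mono) auto
      also have "\<dots> \<le> (2 ^ q * K) * (2 ^ r) ^ q"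
        using K \<open>q \<ge> 2\<close> by (intro mult_right_mono power_increasing) auto
      finally show ?thesis
        by (simp add: power_mult_distrib mult_ac)
    qed
    ultimately show ?case by blast
  qed
  with K show ?thesis using that by blast
qed

section \<open>From tail bounds and moments to an almost sure bound\<close>

definition lil_scale :: "nat \<Rightarrow> real" where
  "lil_scale n = sqrt (2 * real n * ln (ln (real n)))"

lemma lil_scale_mono:
  assumes "3 \<le> m" "m \<le> n"
  shows "0 \<le> lil_scale m" "lil_scale m \<le> lil_scale n"
proof -
  have "1 \<le> ln (real m)"
    using assms exp_le by (simp add: ln_ge_iff)
  moreover have "ln (real m) \<le> ln (real n)"
    using assms by simp
  ultimately have "0 \<le> ln (ln (real m))" "ln (ln (real m)) \<le> ln (ln (real n))"
    by auto
  with assms show "0 \<le> lil_scale m" "lil_scale m \<le> lil_scale n"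
    unfolding lil_scale_def by (auto intro!: mult_mono)
qed

lemma (in prob_space) increment_tail:
  fixes S :: "nat \<Rightarrow> 'a \<Rightarrow> real"
  assumes B: "integrable M B" "\<And>\<omega> j. j \<le> m \<Longrightarrow> (S (k + j) \<omega> - S k \<omega>) ^ (2 * q) \<le> B \<omega>"
    and [measurable]: "\<And>n. S n \<in> borel_measurable M"
    and "t > 0" "q > 0"
  shows "prob {\<omega> \<in> space M. \<exists>j\<le>m. t \<le> \<bar>S (k + j) \<omega> - S k \<omega>\<bar>} \<le> integral\<^sup>L M B / t ^ (2 * q)"
proof -
  have [measurable]: "B \<in> borel_measurable M" using B by auto
  have "B \<omega> \<ge> 0" for \<omega>
    using B(2)[of 0 \<omega>] \<open>q > 0\<close> by (simp add: zero_power)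
  have "prob {\<omega> \<in> space M. \<exists>j\<le>m. t \<le> \<bar>S (k + j) \<omega> - S k \<omega>\<bar>} \<le> prob {\<omega> \<in> space M. t ^ (2 * q) \<le> B \<omega>}"
  proof (rule finite_measure_mono)
    show "{\<omega> \<in> space M. \<exists>j\<le>m. t \<le> \<bar>S (k + j) \<omega> - S k \<omega>\<bar>} \<subseteq> {\<omega> \<in> space M. t ^ (2 * q) \<le> B \<omega>}"
    proof safe
      fix \<omega> j assume j: "j \<le> m" "t \<le> \<bar>S (k + j) \<omega> - S k \<omega>\<bar>"
      then have "t ^ (2 * q) \<le> \<bar>S (k + j) \<omega> - S k \<omega>\<bar> ^ (2 * q)"
        using \<open>t > 0\<close> by (intro power_mono) auto
      also have "\<dots> \<le> B \<omega>"
        using B(2)[OF j(1)] by (simp add: power_even_abs)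
      finally show "t ^ (2 * q) \<le> B \<omega>" .
    qed
  qed measurable
  also have "\<dots> \<le> integral\<^sup>L M B / t ^ (2 * q)"
    using B \<open>t > 0\<close> \<open>\<And>\<omega>. B \<omega> \<ge> 0\<close>
    by (intro integral_Markov_inequality_measure[where A = "space M"]) auto
  finally show ?thesis .
qed

text \<open>
  If the tails of \<open>S n\<close> at level \<open>r * lil_scale n\<close> are of order \<open>(ln n) powr (- c)\<close> with \<open>c > 1\<close>, the
  Borel--Cantelli lemma applies along geometrically growing times. Between \<open>2 ^ j\<close> and \<open>2 ^ (j + 1)\<close>
  the sums would have to be controlled by a maximal inequality that preserves the constant, which
  would require independence. Instead the dyadic interval is cut into about \<open>j powr \<beta>\<close> blocks
  of equal length. With \<open>\<beta> < c - 1\<close> the tail bounds at all block ends are still summable over \<open>j\<close>,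
  while the fluctuation within a block is so much smaller than the scale that high moments bound its
  probability by an arbitrarily high power of \<open>1 / j\<close>.
\<close>

lemma (in prob_space) eventually_le_lil_scale:
  fixes S :: "nat \<Rightarrow> 'a \<Rightarrow> real"
  assumes S_meas [measurable]: "\<And>n. S n \<in> borel_measurable M"
    and int: "\<And>k m q. integrable M (\<lambda>\<omega>. (S (k + m) \<omega> - S k \<omega>) ^ (2 * q))"
    and moment: "\<And>q. \<exists>C. \<forall>k m. (\<integral>\<omega>. (S (k + m) \<omega> - S k \<omega>) ^ (2 * q) \<partial>M) \<le> C * real m ^ q"
    and tail: "\<forall>\<^sub>F n in sequentially. prob {\<omega> \<in> space M. r * lil_scale n \<le> \<bar>S n \<omega>\<bar>} \<le> C * ln (real n) powr (- c)"
    and "C \<ge> 0" "c > 1" "r > 0" "r < s"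
  shows "AE \<omega> in M. \<forall>\<^sub>F n in sequentially. \<bar>S n \<omega>\<bar> \<le> s * lil_scale n"
proof -
  \<comment> \<open>\<open>j powr \<beta>\<close> blocks with tail \<open>j powr (- c)\<close> each give \<open>j powr (\<beta> - c)\<close>, and \<open>\<beta> - c < - 1\<close>.\<close>
  define \<beta> where "\<beta> = (c - 1) / 2"
  have "\<beta> > 0" using \<open>c > 1\<close> by (simp add: \<beta>_def)
  \<comment> \<open>The \<open>2 q\<close>-th moments bound the fluctuations within the \<open>N\<close> blocks by a multiple of
    \<open>N * N powr (- q)\<close>, that is, of \<open>j powr (- \<beta> * (q - 1))\<close>.\<close>
  obtain q where q: "q \<ge> 2" "\<beta> * real (q - 1) \<ge> 2"
  proof -
    obtain q0 :: nat where "2 / \<beta> < real q0" using reals_Archimedean2 by blast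
    then show ?thesis
    proof (intro that[of "q0 + 2"])
      have "2 \<le> \<beta> * real q0"
        using \<open>2 / \<beta> < real q0\<close> \<open>\<beta> > 0\<close> by (simp add: field_simps)
      also have "\<dots> \<le> \<beta> * real (q0 + 2 - 1)"
        using \<open>\<beta> > 0\<close> by (intro mult_left_mono) auto
      finally show "2 \<le> \<beta> * real (q0 + 2 - 1)" .
    qed simp
  qed
  obtain C2 where C2: "\<And>k m. (\<integral>\<omega>. (S (k + m) \<omega> - S k \<omega>) ^ (2 * q) \<partial>M) \<le> C2 * real m ^ q"
    using moment by blast
  obtain K where K: "K \<ge> 0"
    "\<And>k r. \<exists>B. integrable M B \<and> (\<forall>\<omega>. \<forall>j\<le>2 ^ r. (S (k + j) \<omega> - S k \<omega>) ^ (2 * q) \<le> B \<omega>) \<and>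
       integral\<^sup>L M B \<le> K * (2 ^ r) ^ q"
    using dyadic_increment_envelope[OF q(1) int C2] by blast
  define \<epsilon> where "\<epsilon> = s - r"
  have "\<epsilon> > 0" using \<open>r < s\<close> by (simp add: \<epsilon>_def)
  have "\<forall>\<^sub>F n in sequentially. 1 / 2 \<le> ln (ln (real n))" by real_asymp
  with tail have "\<forall>\<^sub>F n in sequentially. prob {\<omega> \<in> space M. r * lil_scale n \<le> \<bar>S n \<omega>\<bar>} \<le> C * ln (real n) powr (- c)
      \<and> 1 / 2 \<le> ln (ln (real n))"
    by eventually_elim auto
  then obtain n0 where n0: "\<And>n. n \<ge> n0 \<Longrightarrow> prob {\<omega> \<in> space M. r * lil_scale n \<le> \<bar>S n \<omega>\<bar>} \<le> C * ln (real n) powr (- c)"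
    "\<And>n. n \<ge> n0 \<Longrightarrow> 1 / 2 \<le> ln (ln (real n))"
    by (auto simp: eventually_sequentially)
  define A where "A j = {\<omega> \<in> space M. \<exists>n\<in>{2 ^ j..<2 ^ (j + 1)}. s * lil_scale n < \<bar>S n \<omega>\<bar>}" for j :: nat
  have A_meas: "A j \<in> events" for j
    unfolding A_def by measurable
  define C3 where "C3 = C * ln 2 powr (- c)"
  define K3 where "K3 = K / \<epsilon> ^ (2 * q) * 2 ^ (q - 1)"
  have bound: "prob (A j) \<le> C3 * real j powr (\<beta> - c) + K3 * real j powr (- 2)"
    if j: "j \<ge> 2" "2 ^ j \<ge> n0" "real j powr \<beta> \<le> 2 ^ j" for j
  proof -
    have "real j powr \<beta> \<ge> 1" using j \<open>\<beta> > 0\<close> by (simp add: ge_one_powr_ge_zero)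
    then obtain i where i: "2 ^ i \<le> real j powr \<beta>" "real j powr \<beta> < 2 ^ (i + 1)"
    proof -
      define i where "i = nat \<lfloor>log 2 (real j powr \<beta>)\<rfloor>"
      have l: "log 2 (real j powr \<beta>) \<ge> 0"
        using \<open>real j powr \<beta> \<ge> 1\<close> j(1) by (subst zero_le_log_cancel_iff) auto
      then have "real i \<le> log 2 (real j powr \<beta>)" "log 2 (real j powr \<beta>) < real (i + 1)"
        unfolding i_def by linarith+
      then have "2 powr real i \<le> real j powr \<beta>" "real j powr \<beta> < 2 powr real (i + 1)"
        using j(1) by (simp_all add: le_log_iff log_less_iff)
      then show ?thesis
        by (intro that[of i]) (simp_all only: powr_realpow zero_less_numeral)
    qed
    have "(2::real) ^ i \<le> 2 ^ j" using i(1) j(3) by linarith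
    then have "i \<le> j" by simp
    \<comment> \<open>\<open>N\<close> is the number of blocks and \<open>w\<close> their length, so the block ends in \<open>{2 ^ j..<2 ^ (j + 1)}\<close>
      are \<open>u * w\<close> with \<open>N \<le> u < 2 * N\<close>.\<close>
    define N :: nat where "N = 2 ^ i"
    define w :: nat where "w = 2 ^ (j - i)"
    have Nw: "N * w = 2 ^ j" "w > 0" "N > 0"
      using \<open>i \<le> j\<close> by (simp_all add: N_def w_def flip: power_add)
    define T where "T u = {\<omega> \<in> space M. r * lil_scale (u * w) \<le> \<bar>S (u * w) \<omega>\<bar>}" for u
    define D where "D u = {\<omega> \<in> space M. \<exists>d\<le>w. \<epsilon> * lil_scale (u * w) \<le> \<bar>S (u * w + d) \<omega> - S (u * w) \<omega>\<bar>}" for u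
    have [measurable]: "T u \<in> events" "D u \<in> events" for u
      unfolding T_def D_def by measurable
    have large: "2 ^ j \<le> u * w" "n0 \<le> u * w" "3 \<le> u * w" if "N \<le> u" for u
    proof -
      show *: "2 ^ j \<le> u * w" using that by (simp flip: Nw(1))
      then show "n0 \<le> u * w" using j by linarith
      have "(2::nat) ^ 2 \<le> 2 ^ j" using j by (intro power_increasing) auto
      then show "3 \<le> u * w" using * by simp
    qed
    have "A j \<subseteq> (\<Union>u\<in>{N..<2 * N}. T u \<union> D u)"
    proof
      fix \<omega> assume "\<omega> \<in> A j"
      then obtain n where \<omega>: "\<omega> \<in> space M" and n: "2 ^ j \<le> n" "n < 2 ^ (j + 1)" "s * lil_scale n < \<bar>S n \<omega>\<bar>"
        by (auto simp: A_def)
      define u where "u = n div w"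
      define d where "d = n mod w"
      have nud: "n = u * w + d" "d < w"
        using Nw by (simp_all add: u_def d_def)
      have "N \<le> u"
        unfolding u_def using div_le_mono[OF n(1), of w] Nw(2) by (simp flip: Nw(1))
      have "u < 2 * N"
        unfolding u_def using n(2) Nw(1) by (intro less_mult_imp_div_less) simp
      have "lil_scale (u * w) \<le> lil_scale n" "0 \<le> lil_scale (u * w)"
        using lil_scale_mono[OF large(3)[OF \<open>N \<le> u\<close>], of n] nud by auto
      then have "s * lil_scale (u * w) \<le> s * lil_scale n"
        using \<open>r > 0\<close> \<open>r < s\<close> by (intro mult_left_mono) auto
      then have "r * lil_scale (u * w) + \<epsilon> * lil_scale (u * w) < \<bar>S n \<omega>\<bar>"
        using n by (simp add: \<epsilon>_def algebra_simps)
      then have "r * lil_scale (u * w) \<le> \<bar>S (u * w) \<omega>\<bar> \<or> \<epsilon> * lil_scale (u * w) \<le> \<bar>S (u * w + d) \<omega> - S (u * w) \<omega>\<bar>"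
        unfolding nud(1) by linarith
      then have "\<omega> \<in> T u \<union> D u"
        using \<omega> \<open>d < w\<close> by (auto simp: T_def D_def)
      then show "\<omega> \<in> (\<Union>u\<in>{N..<2 * N}. T u \<union> D u)"
        using \<open>N \<le> u\<close> \<open>u < 2 * N\<close> by auto
    qed
    then have "prob (A j) \<le> prob (\<Union>u\<in>{N..<2 * N}. T u \<union> D u)"
      by (intro finite_measure_mono) auto
    also have "\<dots> \<le> (\<Sum>u\<in>{N..<2 * N}. prob (T u \<union> D u))"
      by (intro finite_measure_subadditive_finite) auto
    also have "\<dots> \<le> (\<Sum>u\<in>{N..<2 * N}. C3 * real j powr (- c) + K / \<epsilon> ^ (2 * q) / real N ^ q)"
    proof (intro sum_mono)
      fix u assume "u \<in> {N..<2 * N}"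
      then have u: "N \<le> u" by simp
      note large = large[OF u]
      have jw: "real (2 ^ j) \<le> real (u * w)"
        using large(1) by (rule of_nat_mono)
      have "prob (T u) \<le> C * ln (real (u * w)) powr (- c)"
        unfolding T_def by (rule n0) (rule large)
      also have "\<dots> \<le> C * (real j * ln 2) powr (- c)"
      proof -
        have "real j * ln 2 = ln (real (2 ^ j))"
          by (simp add: ln_realpow)
        also have "\<dots> \<le> ln (real (u * w))"
          using jw large(3) by (intro ln_mono) auto
        finally show ?thesis
          using \<open>C \<ge> 0\<close> j(1) \<open>c > 1\<close> by (intro mult_left_mono powr_mono2') auto
      qed
      also have "\<dots> = C3 * real j powr (- c)"
        using j(1) by (simp add: C3_def powr_mult)
      finally have T: "prob (T u) \<le> C3 * real j powr (- c)" .
      have ll: "1 \<le> 2 * ln (ln (real (u * w)))"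
        using n0(2)[OF large(2)] by simp
      have "real (2 ^ j) * 1 \<le> real (u * w) * (2 * ln (ln (real (u * w))))"
        by (rule mult_mono[OF jw ll]) auto
      then have sq: "2 ^ j \<le> 2 * real (u * w) * ln (ln (real (u * w)))"
        by (simp add: mult_ac)
      then have "2 * real (u * w) * ln (ln (real (u * w))) > 0"
        by (smt (verit) zero_less_power)
      then have "lil_scale (u * w) > 0" "(lil_scale (u * w))\<^sup>2 = 2 * real (u * w) * ln (ln (real (u * w)))"
        unfolding lil_scale_def by simp_all
      with sq have scale: "lil_scale (u * w) > 0" "2 ^ j \<le> (lil_scale (u * w))\<^sup>2"
        by simp_all
      obtain B where B: "integrable M B"
        "\<And>\<omega> d. d \<le> w \<Longrightarrow> (S (u * w + d) \<omega> - S (u * w) \<omega>) ^ (2 * q) \<le> B \<omega>"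
        "integral\<^sup>L M B \<le> K * real w ^ q"
        using K(2)[of "j - i" "u * w"] unfolding w_def by auto
      have "prob (D u) \<le> integral\<^sup>L M B / (\<epsilon> * lil_scale (u * w)) ^ (2 * q)"
        unfolding D_def using scale \<open>\<epsilon> > 0\<close> q by (intro increment_tail B) auto
      also have "\<dots> \<le> (K * real w ^ q) / (\<epsilon> * lil_scale (u * w)) ^ (2 * q)"
        using B by (intro divide_right_mono) (auto simp: zero_le_even_power)
      also have "\<dots> = (K / \<epsilon> ^ (2 * q)) * (real w ^ q / ((lil_scale (u * w))\<^sup>2) ^ q)"
        by (simp add: power_mult_distrib power_mult)
      also have "\<dots> \<le> (K / \<epsilon> ^ (2 * q)) * (real w ^ q / (2 ^ j) ^ q)"
        using scale \<open>K \<ge> 0\<close> \<open>\<epsilon> > 0\<close> by (intro mult_left_mono divide_left_mono power_mono) auto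
      also have "real w ^ q / (2 ^ j) ^ q = 1 / real N ^ q"
      proof -
        have "(2 ^ j :: real) = real N * real w"
          using Nw(1) by (metis of_nat_mult of_nat_numeral of_nat_power)
        then show ?thesis using Nw by (simp add: power_mult_distrib)
      qed
      finally have D: "prob (D u) \<le> K / \<epsilon> ^ (2 * q) / real N ^ q" by simp
      have "prob (T u \<union> D u) \<le> prob (T u) + prob (D u)"
        by (intro measure_Un_le) auto
      with T D show "prob (T u \<union> D u) \<le> C3 * real j powr (- c) + K / \<epsilon> ^ (2 * q) / real N ^ q"
        by linarith
    qed
    also have "\<dots> = C3 * (real N * real j powr (- c)) + K / \<epsilon> ^ (2 * q) * (real N / real N ^ q)"
      by (simp add: algebra_simps)
    also have "\<dots> \<le> C3 * real j powr (\<beta> - c) + K / \<epsilon> ^ (2 * q) * (2 ^ (q - 1) * real j powr (- 2))"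
    proof (intro add_mono mult_left_mono)
      have "real N * real j powr (- c) \<le> real j powr \<beta> * real j powr (- c)"
        using i by (intro mult_right_mono) (auto simp: N_def)
      then show "real N * real j powr (- c) \<le> real j powr (\<beta> - c)"
        by (simp flip: powr_add)
      have "real j powr \<beta> / 2 \<le> real N"
        using i(2) by (simp add: N_def)
      then have "(real j powr \<beta> / 2) ^ (q - 1) \<le> real N ^ (q - 1)"
        by (intro power_mono) auto
      have "real N / real N ^ q = 1 / real N ^ (q - 1)"
        using Nw q(1) power_Suc[of "real N" "q - 1"] by simp
      also have "\<dots> \<le> 1 / (real j powr \<beta> / 2) ^ (q - 1)"
        using \<open>(real j powr \<beta> / 2) ^ (q - 1) \<le> real N ^ (q - 1)\<close> j(1) Nw
        by (intro divide_left_mono mult_pos_pos zero_less_power) auto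
      also have "\<dots> = 2 ^ (q - 1) * real j powr (- (\<beta> * real (q - 1)))"
      proof -
        have "(real j powr \<beta>) ^ (q - 1) = real j powr (\<beta> * real (q - 1))"
          using j(1) powr_realpow[of "real j powr \<beta>" "q - 1"] by (simp add: powr_powr)
        then have "1 / (real j powr \<beta> / 2) ^ (q - 1) = 2 ^ (q - 1) * (1 / real j powr (\<beta> * real (q - 1)))"
          by (simp only: power_divide) simp
        then show ?thesis
          by (simp only: powr_minus_divide)
      qed
      also have "\<dots> \<le> 2 ^ (q - 1) * real j powr (- 2)"
      proof -
        have "- (\<beta> * real (q - 1)) \<le> - 2" using q(2) by (simp only: neg_le_iff_le)
        then have "real j powr (- (\<beta> * real (q - 1))) \<le> real j powr (- 2)"
          using j(1) by (intro powr_mono) linarith+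
        then show ?thesis by (rule mult_left_mono) simp
      qed
      finally show "real N / real N ^ q \<le> 2 ^ (q - 1) * real j powr (- 2)" .
    qed (use \<open>C \<ge> 0\<close> \<open>K \<ge> 0\<close> in \<open>auto simp: C3_def zero_le_even_power\<close>)
    finally show ?thesis by (simp add: K3_def)
  qed
  have "summable (\<lambda>j. prob (A j))"
  proof (rule summable_comparison_test_ev)
    have "\<forall>\<^sub>F j in sequentially. real j powr \<beta> \<le> 2 ^ j"
      using \<open>\<beta> > 0\<close> by real_asymp
    moreover have "\<forall>\<^sub>F j in sequentially. real n0 \<le> 2 ^ j" by real_asymp
    moreover have "\<forall>\<^sub>F j in sequentially. (2::nat) \<le> j" by (rule eventually_ge_at_top)
    ultimately show "\<forall>\<^sub>F j in sequentially. norm (prob (A j))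
        \<le> C3 * real j powr (\<beta> - c) + K3 * real j powr (- 2)"
    proof eventually_elim
      case (elim j)
      have "real n0 \<le> real (2 ^ j)" using elim(2) by simp
      then have "n0 \<le> 2 ^ j" by (rule of_nat_le_iff[THEN iffD1])
      with elim have "prob (A j) \<le> C3 * real j powr (\<beta> - c) + K3 * real j powr (- 2)"
        by (intro bound)
      then show ?case by simp
    qed
    have "\<beta> - c < - 1" using \<open>c > 1\<close> by (simp add: \<beta>_def field_simps)
    then show "summable (\<lambda>j. C3 * real j powr (\<beta> - c) + K3 * real j powr (- 2))"
      by (intro summable_add summable_mult) (simp_all add: summable_real_powr_iff)
  qed
  then have "AE \<omega> in M. \<forall>\<^sub>F j in sequentially. \<omega> \<in> space M - A j"
    by (intro borel_cantelli_AE1 A_meas) (auto simp: emeasure_eq_measure)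
  then show ?thesis
  proof (rule AE_mp, intro AE_I2 impI)
    fix \<omega> assume \<omega>: "\<omega> \<in> space M" "\<forall>\<^sub>F j in sequentially. \<omega> \<in> space M - A j"
    then obtain J where J: "\<And>j. j \<ge> J \<Longrightarrow> \<omega> \<notin> A j"
      by (auto simp: eventually_sequentially)
    have "\<bar>S n \<omega>\<bar> \<le> s * lil_scale n" if n: "n \<ge> 2 ^ J" for n
    proof -
      have "n \<ge> 1" using n by (meson le_trans one_le_numeral one_le_power)
      then obtain j where j: "2 ^ j \<le> n" "n < 2 ^ (j + 1)"
        using ex_power_ivl1[of 2 n] by auto
      have "J < j + 1"
      proof (rule ccontr)
        assume "\<not> J < j + 1"
        then have "(2::nat) ^ (j + 1) \<le> 2 ^ J" by (intro power_increasing) auto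
        with n j show False by linarith
      qed
      then show ?thesis
        using J[of j] j \<omega>(1) unfolding A_def by (auto simp: not_less)
    qed
    then show "\<forall>\<^sub>F n in sequentially. \<bar>S n \<omega>\<bar> \<le> s * lil_scale n"
      by (auto simp: eventually_sequentially)
  qed
qed

section \<open>Upper expectations\<close>

context sublinear_expectation_setting
begin

lemma upper_expectation_leI:
  assumes "\<And>P. P \<in> Q \<Longrightarrow> integral\<^sup>L P Y \<le> c"
  shows "upper_expectation Q Y \<le> c"
  unfolding upper_expectation_def using assms by (intro cSUP_least Q_nonempty)

lemma integral_le_upper_expectation:
  assumes "Y \<in> H" "P \<in> Q"
  shows "integral\<^sup>L P Y \<le> upper_expectation Q Y"
  unfolding upper_expectation_def using assms by (intro cSUP_upper upper_bounded)

lemma upper_expectation_const: "upper_expectation Q (\<lambda>_. c) = c"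
proof -
  have "integral\<^sup>L P (\<lambda>_. c) = c" if "P \<in> Q" for P
    using prob_space.prob_space[OF Q_prob_space[OF that]] by simp
  then have "upper_expectation Q (\<lambda>_. c) = (SUP P\<in>Q. c)"
    unfolding upper_expectation_def by (intro SUP_cong) auto
  with Q_nonempty show ?thesis by simp
qed

lemma upper_expectation_nonneg:
  assumes "Y \<in> H" "\<And>\<omega>. Y \<omega> \<ge> 0"
  shows "upper_expectation Q Y \<ge> 0"
proof -
  obtain P where "P \<in> Q" using Q_nonempty by blast
  then show ?thesis
    using integral_le_upper_expectation[OF assms(1)] integral_nonneg_AE[of Y P] assms(2)
    by (meson AE_I2 order_trans)
qed

lemma comp_in_H:
  assumes "\<phi> \<in> C_lLip" "Y \<in> H"
  shows "(\<lambda>\<omega>. \<phi> (Y \<omega>)) \<in> H"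
  using H_closed[of 1 "\<lambda>_. Y" "\<lambda>x. \<phi> (x 0)"] assms by (simp add: C_lLip_dim_1[unfolded One_nat_def])

lemma add_in_H:
  assumes "Y \<in> H" "Z \<in> H"
  shows "(\<lambda>\<omega>. Y \<omega> + Z \<omega>) \<in> H"
proof -
  have "(\<lambda>x :: nat \<Rightarrow> real. x 0 + x 1) \<in> C_lLip_dim 2"
    unfolding C_lLip_dim_def mem_Collect_eq
  proof (intro exI conjI allI)
    fix x y :: "nat \<Rightarrow> real"
    have "\<bar>x i - y i\<bar> \<le> L2_set (\<lambda>i. x i - y i) {..<2}" if "i < 2" for i
      using member_le_L2_set[of "{..<2}" i "\<lambda>i. \<bar>x i - y i\<bar>"] that by (simp add: L2_set_def)
    from this[of 0] this[of 1]
    show "\<bar>x 0 + x 1 - (y 0 + y 1)\<bar>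
        \<le> 1 * (1 + L2_set x {..<2} ^ 0 + L2_set y {..<2} ^ 0) * L2_set (\<lambda>i. x i - y i) {..<2}"
      by simp
  qed simp
  then show ?thesis
    using H_closed[of 2 "\<lambda>i. if i = 0 then Y else Z" "\<lambda>x. x 0 + x 1"] assms by simp
qed

end

section \<open>Sums of a convolutionary sequence\<close>

text \<open>
  Vanishing upper and lower expectation of \<open>X 1\<close> amount to vanishing mean under every measure in
  \<open>Q\<close>, which is the form in which linear terms are integrated away.
\<close>

locale centred_convolutionary_sequence = sublinear_expectation_setting F Q H
  for F :: "'a measure" and Q :: "'a measure set" and H :: "('a \<Rightarrow> real) set" +
  fixes X :: "nat \<Rightarrow> 'a \<Rightarrow> real"
  assumes X_in_H: "\<And>i. i \<ge> 1 \<Longrightarrow> X i \<in> H"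
    and convolutionary: "convolutionary Q X"
    and identical: "\<And>i. i \<ge> 1 \<Longrightarrow> identically_distributed Q (X i) (X 1)"
    and mean_zero: "\<And>P. P \<in> Q \<Longrightarrow> integral\<^sup>L P (X 1) = 0"
begin

definition block :: "nat \<Rightarrow> nat \<Rightarrow> 'a \<Rightarrow> real" where
  "block k m \<omega> = (\<Sum>i=k+1..k+m. X i \<omega>)"

lemma block_0 [simp]: "block k 0 \<omega> = 0"
  by (simp add: block_def)

lemma block_Suc: "block k (Suc m) \<omega> = block k m \<omega> + X (k + m + 1) \<omega>"
  by (simp add: block_def)

lemma block_diff: "block 0 (k + m) \<omega> - block 0 k \<omega> = block k m \<omega>"
  by (induction m) (simp_all add: block_Suc algebra_simps)

lemma const_in_H: "(\<lambda>_. c) \<in> H"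
  using comp_in_H[OF C_lLip_const X_in_H[of 1]] by simp

lemma block_in_H: "block k m \<in> H"
proof (induction m)
  case 0
  then show ?case using const_in_H[of 0] by (simp add: block_def[abs_def])
next
  case (Suc m)
  then show ?case
    using add_in_H[OF Suc X_in_H[of "k + m + 1"]] by (simp add: block_Suc[abs_def])
qed

text \<open>
  An expansion of \<open>\<phi>\<close> around \<open>x\<close> is integrated against \<open>X 1\<close>: the linear term vanishes whatever the sign
  of its coefficient, the other terms are bounded by upper expectations as their coefficients are
  nonnegative.
\<close>

lemma upper_expectation_shift_le:
  assumes "\<phi> \<in> C_lLip" "w \<in> C_lLip" "c \<ge> 0" "d \<ge> 0"
    and le: "\<And>h. \<phi> (x + h) \<le> a + b * h + c * h\<^sup>2 + d * w h"
  shows "upper_expectation Q (\<lambda>\<omega>. \<phi> (x + X 1 \<omega>))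
    \<le> a + c * upper_expectation Q (\<lambda>\<omega>. (X 1 \<omega>)\<^sup>2) + d * upper_expectation Q (\<lambda>\<omega>. w (X 1 \<omega>))"
proof (rule upper_expectation_leI)
  fix P assume P: "P \<in> Q"
  interpret prob_space P using P by (rule Q_prob_space)
  have X1: "X 1 \<in> H" "(\<lambda>\<omega>. (X 1 \<omega>)\<^sup>2) \<in> H" "(\<lambda>\<omega>. w (X 1 \<omega>)) \<in> H" "(\<lambda>\<omega>. \<phi> (x + X 1 \<omega>)) \<in> H"
    using X_in_H[of 1] comp_in_H[OF C_lLip_power X_in_H[of 1]] comp_in_H[OF assms(2) X_in_H[of 1]]
      comp_in_H[OF C_lLip_shift[OF assms(1)] X_in_H[of 1]] by auto
  note int = X1[THEN H_integrable, OF P]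
  have "(\<integral>\<omega>. \<phi> (x + X 1 \<omega>) \<partial>P) \<le> (\<integral>\<omega>. a + b * X 1 \<omega> + c * (X 1 \<omega>)\<^sup>2 + d * w (X 1 \<omega>) \<partial>P)"
    using int by (intro integral_mono le) auto
  also have "\<dots> = a + c * (\<integral>\<omega>. (X 1 \<omega>)\<^sup>2 \<partial>P) + d * (\<integral>\<omega>. w (X 1 \<omega>) \<partial>P)"
    using int mean_zero[OF P] by (simp add: prob_space)
  also have "\<dots> \<le> a + c * upper_expectation Q (\<lambda>\<omega>. (X 1 \<omega>)\<^sup>2) + d * upper_expectation Q (\<lambda>\<omega>. w (X 1 \<omega>))"
    using assms X1 P by (intro add_mono mult_left_mono integral_le_upper_expectation) auto
  finally show "(\<integral>\<omega>. \<phi> (x + X 1 \<omega>) \<partial>P) \<le> \<dots>" .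
qed

text \<open>
  The only place where the convolution property enters. It takes the role of conditioning on
  the previous summands: a bound for the effect of one summand started at \<open>x\<close>, uniform in \<open>x\<close>,
  becomes a recursion for the block sums. The bound is affine in \<open>\<phi>\<close> and in a second function \<open>w\<close>;
  for moments \<open>w\<close> is the power of next lower even order, for the capped exponential it is \<open>0\<close>.
\<close>

lemma upper_expectation_block_Suc_le:
  assumes "\<phi> \<in> C_lLip" "w \<in> C_lLip" "\<And>x. \<phi> x \<ge> 0" "\<And>x. w x \<ge> 0"
    and "A \<ge> 0" "B \<ge> 0" "\<eta> \<ge> 0"
    and step: "\<And>x. upper_expectation Q (\<lambda>\<omega>. \<phi> (x + X 1 \<omega>)) \<le> A * \<phi> x + B * w x + \<eta>"
  shows "upper_expectation Q (\<lambda>\<omega>. \<phi> (block k (Suc m) \<omega>))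
    \<le> A * upper_expectation Q (\<lambda>\<omega>. \<phi> (block k m \<omega>)) + B * upper_expectation Q (\<lambda>\<omega>. w (block k m \<omega>)) + \<eta>"
proof -
  have step': "upper_expectation Q (\<lambda>\<omega>. \<phi> (x + X i \<omega>)) \<le> A * \<phi> x + B * w x + \<eta>" if "i \<ge> 1" for x i
    using bspec[OF identical[OF that, unfolded identically_distributed_def] C_lLip_shift[OF assms(1), of x]]
      step[of x] by simp
  show ?thesis
  proof (cases "m = 0")
    \<comment> \<open>The convolution property speaks of nonempty sums; the first summand is a shift from \<open>0\<close>.\<close>
    case True
    then show ?thesis
      using step'[of "k + 1" 0] by (simp add: block_Suc upper_expectation_const)
  next
    case False
    have "of_convolution Q (block k m) (X (k + m + 1))"
      using convolutionary[unfolded convolutionary_def, rule_format, of "k + m" "k + 1"] False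
      by (simp add: block_def[abs_def])
    then have "upper_expectation Q (\<lambda>\<omega>. \<phi> (block k (Suc m) \<omega>))
      = upper_expectation Q (\<lambda>\<omega>. upper_expectation Q (\<lambda>\<omega>'. \<phi> (block k m \<omega> + X (k + m + 1) \<omega>')))"
      using assms(1) by (simp add: of_convolution_def block_Suc)
    also have "\<dots> \<le> A * upper_expectation Q (\<lambda>\<omega>. \<phi> (block k m \<omega>)) + B * upper_expectation Q (\<lambda>\<omega>. w (block k m \<omega>)) + \<eta>"
    proof (rule upper_expectation_leI)
      fix P assume P: "P \<in> Q"
      interpret prob_space P using P by (rule Q_prob_space)
      have in_H: "(\<lambda>\<omega>. \<phi> (block k m \<omega>)) \<in> H" "(\<lambda>\<omega>. w (block k m \<omega>)) \<in> H"
        using assms by (auto intro: comp_in_H block_in_H)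
      note int = in_H[THEN H_integrable, OF P]
      have "(\<integral>\<omega>. upper_expectation Q (\<lambda>\<omega>'. \<phi> (block k m \<omega> + X (k + m + 1) \<omega>')) \<partial>P)
          \<le> (\<integral>\<omega>. A * \<phi> (block k m \<omega>) + B * w (block k m \<omega>) + \<eta> \<partial>P)"
        using int assms by (intro integral_mono' step') auto
      also have "\<dots> = A * (\<integral>\<omega>. \<phi> (block k m \<omega>) \<partial>P) + B * (\<integral>\<omega>. w (block k m \<omega>) \<partial>P) + \<eta>"
        using int by (simp add: prob_space)
      also have "\<dots> \<le> A * upper_expectation Q (\<lambda>\<omega>. \<phi> (block k m \<omega>)) + B * upper_expectation Q (\<lambda>\<omega>. w (block k m \<omega>)) + \<eta>"
        using assms in_H P by (intro add_mono mult_left_mono integral_le_upper_expectation) auto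
      finally show "(\<integral>\<omega>. upper_expectation Q (\<lambda>\<omega>'. \<phi> (block k m \<omega> + X (k + m + 1) \<omega>')) \<partial>P) \<le> \<dots>" .
    qed
    finally show ?thesis .
  qed
qed

text \<open>
  The moments of block sums have the order that the central limit theorem suggests. The \<open>2 (p + 1)\<close>-th
  moment increases, per summand, by at most a multiple of the \<open>2 p\<close>-th moment plus a constant,
  hence by \<open>O (m ^ p)\<close>.
\<close>

lemma even_moment_bound:
  "\<exists>C\<ge>0. \<forall>k m. upper_expectation Q (\<lambda>\<omega>. block k m \<omega> ^ (2 * p)) \<le> C * real m ^ p"
proof (induction p)
  case 0
  then show ?case by (intro exI[of _ 1]) (simp add: upper_expectation_const)
next
  case (Suc p)
  then obtain C where C: "C \<ge> 0"
    "\<And>k m. upper_expectation Q (\<lambda>\<omega>. block k m \<omega> ^ (2 * p)) \<le> C * real m ^ p" by blast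
  define c where "c = real (2 * Suc p) * real (2 * Suc p - 1) * 2 ^ (2 * Suc p - 2)"
  define V where "V = upper_expectation Q (\<lambda>\<omega>. (X 1 \<omega>)\<^sup>2)"
  define M where "M = upper_expectation Q (\<lambda>\<omega>. X 1 \<omega> ^ (2 * Suc p))"
  have nonneg: "V \<ge> 0" "M \<ge> 0" "c \<ge> 0"
    using upper_expectation_nonneg[OF comp_in_H[OF C_lLip_power[of 2] X_in_H[of 1]]]
      upper_expectation_nonneg[OF comp_in_H[OF C_lLip_power[of "2 * Suc p"] X_in_H[of 1]]]
    by (simp_all only: V_def M_def c_def zero_le_even_power' zero_le_power2 zero_le_mult_iff of_nat_0_le_iff)
       (simp_all add: zero_le_even_power)
  define K where "K = c * V * C + c * M"
  have "K \<ge> 0" using nonneg C by (simp add: K_def)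
  have step: "upper_expectation Q (\<lambda>\<omega>. (x + X 1 \<omega>) ^ (2 * Suc p))
      \<le> 1 * x ^ (2 * Suc p) + c * V * x ^ (2 * p) + c * M" for x
    using upper_expectation_shift_le[OF C_lLip_power[of "2 * Suc p"] C_lLip_power[of "2 * Suc p"] _ nonneg(3),
        of "c * x ^ (2 * p)" x "x ^ (2 * Suc p)" "real (2 * Suc p) * x ^ (2 * Suc p - 1)"]
      even_power_expansion[of "Suc p" x] nonneg
    by (simp add: V_def M_def c_def mult_ac zero_le_even_power)
  have "upper_expectation Q (\<lambda>\<omega>. block k m \<omega> ^ (2 * Suc p)) \<le> K * real m ^ Suc p" for k m
  proof (induction m)
    case 0
    then show ?case by (simp add: upper_expectation_const)
  next
    case (Suc m)
    have "upper_expectation Q (\<lambda>\<omega>. block k (Suc m) \<omega> ^ (2 * Suc p))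
      \<le> 1 * upper_expectation Q (\<lambda>\<omega>. block k m \<omega> ^ (2 * Suc p))
        + c * V * upper_expectation Q (\<lambda>\<omega>. block k m \<omega> ^ (2 * p)) + c * M"
      by (rule upper_expectation_block_Suc_le[OF C_lLip_power C_lLip_power
            zero_le_even_power' zero_le_even_power' _ _ _ step]) (use nonneg in auto)
    also have "\<dots> \<le> 1 * (K * real m ^ Suc p) + c * V * (C * real m ^ p) + c * M"
      using nonneg Suc C by (intro add_mono mult_left_mono) auto
    also have "\<dots> \<le> K * (real m * real (Suc m) ^ p) + c * V * (C * real (Suc m) ^ p) + c * M * real (Suc m) ^ p"
    proof (intro add_mono)
      show "1 * (K * real m ^ Suc p) \<le> K * (real m * real (Suc m) ^ p)"
        using \<open>K \<ge> 0\<close> by (simp, intro mult_left_mono power_mono) auto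
      show "c * V * (C * real m ^ p) \<le> c * V * (C * real (Suc m) ^ p)"
        using nonneg C by (intro mult_left_mono power_mono) auto
      show "c * M \<le> c * M * real (Suc m) ^ p"
        using nonneg mult_left_mono[of 1 "real (Suc m) ^ p" "c * M"] by (simp add: one_le_power)
    qed
    also have "\<dots> = K * real (Suc m) ^ Suc p"
      by (simp add: K_def algebra_simps)
    finally show ?case .
  qed
  with \<open>K \<ge> 0\<close> show ?case by blast
qed

text \<open>
  Up to the second factor this is the moment generating function of a Gaussian variable with
  variance \<open>m * V\<close>. The recursion is \<open>e (m + 1) \<le> A * e m + \<eta>\<close> with \<open>A = 1 + l\<^sup>2 * V / 2\<close> and the
  Lipschitz error \<open>\<eta>\<close>, which gives \<open>e m \<le> A ^ m * (1 + m * \<eta>)\<close>.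
\<close>

lemma capped_exp_moment_bound:
  assumes V: "upper_expectation Q (\<lambda>\<omega>. (X 1 \<omega>)\<^sup>2) \<le> V" and "L \<ge> 0"
  defines "M \<equiv> upper_expectation Q (\<lambda>\<omega>. (X 1 \<omega>)\<^sup>2 + X 1 \<omega> ^ 4)"
  shows "upper_expectation Q (\<lambda>\<omega>. capped_exp L (l * block k m \<omega>))
    \<le> exp (real m * l\<^sup>2 * V / 2) * (1 + real m * (exp L * \<bar>l\<bar> ^ 3 * M))"
proof -
  define A where "A = 1 + l\<^sup>2 * V / 2"
  define \<eta> where "\<eta> = exp L * \<bar>l\<bar> ^ 3 * M"
  have "0 \<le> upper_expectation Q (\<lambda>\<omega>. (X 1 \<omega>)\<^sup>2)"
    by (intro upper_expectation_nonneg comp_in_H[OF C_lLip_power] X_in_H) auto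
  with V have "V \<ge> 0" by linarith
  then have "A \<ge> 1" by (simp add: A_def)
  have "M \<ge> 0"
    unfolding M_def by (intro upper_expectation_nonneg comp_in_H[OF C_lLip_square_plus_fourth] X_in_H) auto
  then have "\<eta> \<ge> 0" by (simp add: \<eta>_def)
  have step: "upper_expectation Q (\<lambda>\<omega>. capped_exp L (l * (x + X 1 \<omega>)))
      \<le> A * capped_exp L (l * x) + 0 * 0 + \<eta>" for x
  proof -
    have "upper_expectation Q (\<lambda>\<omega>. capped_exp L (l * (x + X 1 \<omega>)))
      \<le> capped_exp L (l * x) + capped_exp L (l * x) * l\<^sup>2 / 2 * upper_expectation Q (\<lambda>\<omega>. (X 1 \<omega>)\<^sup>2)
        + exp L * \<bar>l\<bar> ^ 3 * M"
      unfolding M_def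
      by (rule upper_expectation_shift_le[OF C_lLip_capped_exp C_lLip_square_plus_fourth _ _ capped_exp_expansion])
         (simp_all add: capped_exp_nonneg)
    also have "\<dots> \<le> capped_exp L (l * x) + capped_exp L (l * x) * l\<^sup>2 / 2 * V + exp L * \<bar>l\<bar> ^ 3 * M"
      using V by (intro add_mono mult_left_mono) (auto simp: capped_exp_nonneg)
    finally show ?thesis by (simp add: A_def \<eta>_def algebra_simps)
  qed
  have "upper_expectation Q (\<lambda>\<omega>. capped_exp L (l * block k m \<omega>)) \<le> A ^ m * (1 + real m * \<eta>)"
  proof (induction m)
    case 0
    then show ?case
      using \<open>L \<ge> 0\<close> by (simp add: upper_expectation_const capped_exp_def)
  next
    case (Suc m)
    have "upper_expectation Q (\<lambda>\<omega>. capped_exp L (l * block k (Suc m) \<omega>))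
      \<le> A * upper_expectation Q (\<lambda>\<omega>. capped_exp L (l * block k m \<omega>)) + 0 * upper_expectation Q (\<lambda>\<omega>. 0) + \<eta>"
      using \<open>A \<ge> 1\<close> \<open>\<eta> \<ge> 0\<close> step
      by (intro upper_expectation_block_Suc_le C_lLip_capped_exp C_lLip_const capped_exp_nonneg) auto
    also have "\<dots> \<le> A * (A ^ m * (1 + real m * \<eta>)) + A ^ Suc m * \<eta>"
    proof -
      have "\<eta> \<le> A ^ Suc m * \<eta>"
        using mult_right_mono[OF one_le_power[OF \<open>A \<ge> 1\<close>, of "Suc m"] \<open>\<eta> \<ge> 0\<close>] by simp
      moreover have "A * upper_expectation Q (\<lambda>\<omega>. capped_exp L (l * block k m \<omega>)) \<le> A * (A ^ m * (1 + real m * \<eta>))"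
        using Suc \<open>A \<ge> 1\<close> by (intro mult_left_mono) auto
      ultimately show ?thesis by linarith
    qed
    also have "\<dots> = A ^ Suc m * (1 + real (Suc m) * \<eta>)"
      by (simp add: algebra_simps)
    finally show ?case .
  qed
  also have "\<dots> \<le> exp (real m * l\<^sup>2 * V / 2) * (1 + real m * \<eta>)"
  proof (rule mult_right_mono)
    have "A ^ m \<le> exp (l\<^sup>2 * V / 2) ^ m"
      using \<open>A \<ge> 1\<close> exp_ge_add_one_self[of "l\<^sup>2 * V / 2"] by (intro power_mono) (auto simp: A_def)
    then show "A ^ m \<le> exp (real m * l\<^sup>2 * V / 2)"
      by (simp add: mult.assoc flip: exp_of_nat_mult)
  qed (use \<open>\<eta> \<ge> 0\<close> in simp)
  finally show ?thesis by (simp add: \<eta>_def)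
qed

lemma block_measurable [measurable]:
  assumes "P \<in> Q" shows "block k m \<in> borel_measurable P"
  using H_measurable block_in_H measurable_cong_sets[OF Q_sets[OF assms] refl] by blast

lemma one_sided_tail:
  assumes V: "upper_expectation Q (\<lambda>\<omega>. (X 1 \<omega>)\<^sup>2) \<le> V" and "L \<ge> 0" and P: "P \<in> Q"
  defines "M \<equiv> upper_expectation Q (\<lambda>\<omega>. (X 1 \<omega>)\<^sup>2 + X 1 \<omega> ^ 4)"
  shows "measure P {\<omega> \<in> space P. L \<le> l * block k m \<omega>}
    \<le> exp (real m * l\<^sup>2 * V / 2) * (1 + real m * (exp L * \<bar>l\<bar> ^ 3 * M)) / exp L"
proof -
  interpret prob_space P using P by (rule Q_prob_space)
  note [measurable] = block_measurable[OF P]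
  define u where "u \<omega> = capped_exp L (l * block k m \<omega>)" for \<omega>
  have u_nonneg: "u \<omega> \<ge> 0" for \<omega>
    by (simp add: u_def capped_exp_nonneg)
  have u: "u \<in> H"
    unfolding u_def by (intro comp_in_H[OF C_lLip_capped_exp] block_in_H)
  then have int: "integrable P u" using P by (rule H_integrable)
  then have [measurable]: "u \<in> borel_measurable P" by auto
  have "prob {\<omega> \<in> space P. L \<le> l * block k m \<omega>} \<le> prob {\<omega> \<in> space P. exp L \<le> u \<omega>}"
  proof (rule finite_measure_mono)
    show "{\<omega> \<in> space P. L \<le> l * block k m \<omega>} \<subseteq> {\<omega> \<in> space P. exp L \<le> u \<omega>}"
      by (auto simp: u_def capped_exp_ge)
  qed measurable
  also have "\<dots> \<le> integral\<^sup>L P u / exp L"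
    using int u_nonneg by (intro integral_Markov_inequality_measure[where A = "space P"]) auto
  also have "\<dots> \<le> upper_expectation Q u / exp L"
    using u P by (intro divide_right_mono integral_le_upper_expectation) auto
  also have "\<dots> \<le> exp (real m * l\<^sup>2 * V / 2) * (1 + real m * (exp L * \<bar>l\<bar> ^ 3 * M)) / exp L"
    unfolding u_def M_def by (intro divide_right_mono capped_exp_moment_bound V \<open>L \<ge> 0\<close>) auto
  finally show ?thesis .
qed

text \<open>
  The exponential Chebyshev inequality at level \<open>t = r * lil_scale n\<close> with the optimal parameter
  \<open>l = t / (n * V)\<close>. The cap \<open>L = t * l\<close> is then only of order \<open>ln (ln n)\<close>, so \<open>exp L\<close> is a power
  of \<open>ln n\<close>, whereas \<open>n * l ^ 3\<close> is of order \<open>n powr (- 1 / 2)\<close> up to powers of \<open>ln (ln n)\<close>. The error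
  caused by capping is therefore negligible. Both signs of \<open>l\<close> together give the absolute value.
\<close>

lemma gaussian_tail:
  assumes V: "upper_expectation Q (\<lambda>\<omega>. (X 1 \<omega>)\<^sup>2) \<le> V" and "V > 0" "r > 0"
  shows "\<forall>\<^sub>F n in sequentially. \<forall>P\<in>Q. measure P {\<omega> \<in> space P. r * lil_scale n \<le> \<bar>block 0 n \<omega>\<bar>}
    \<le> 4 * ln (real n) powr (- (r\<^sup>2 / V))"
proof -
  define M where "M = upper_expectation Q (\<lambda>\<omega>. (X 1 \<omega>)\<^sup>2 + X 1 \<omega> ^ 4)"
  define c where "c = r\<^sup>2 / V"
  have "c > 0" using assms by (simp add: c_def)
  \<comment> \<open>\<open>e n * M\<close> is the capping error for the parameters chosen below.\<close>
  define e where "e n = real n * (exp (2 * c * ln (ln (real n))) * (r * lil_scale n / (real n * V)) ^ 3)" for n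
  have "e \<longlonglongrightarrow> 0"
    unfolding e_def lil_scale_def using \<open>c > 0\<close> \<open>V > 0\<close> \<open>r > 0\<close> by real_asymp
  then have "(\<lambda>n. e n * M) \<longlonglongrightarrow> 0"
    by (rule tendsto_mult_left_zero)
  then have "\<forall>\<^sub>F n in sequentially. e n * M < 1"
    by (rule order_tendstoD) simp
  moreover have "\<forall>\<^sub>F n in sequentially. 0 < ln (ln (real n))" by real_asymp
  moreover have "\<forall>\<^sub>F n in sequentially. 1 < ln (real n)" by real_asymp
  moreover have "\<forall>\<^sub>F n in sequentially. 0 < n" by (rule eventually_gt_at_top)
  ultimately show ?thesis
  proof eventually_elim
    case (elim n)
    define t where "t = r * lil_scale n"
    define l where "l = t / (real n * V)"
    define L where "L = 2 * c * ln (ln (real n))"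
    have "lil_scale n > 0" "(lil_scale n)\<^sup>2 = 2 * real n * ln (ln (real n))"
      using elim by (simp_all add: lil_scale_def)
    then have t: "t > 0" "t\<^sup>2 = r\<^sup>2 * (2 * real n * ln (ln (real n)))"
      using \<open>r > 0\<close> by (simp_all add: t_def power_mult_distrib)
    then have "l > 0" using elim \<open>V > 0\<close> by (simp add: l_def)
    have tl: "t * l = L"
      using elim \<open>V > 0\<close> t(2) by (simp add: l_def L_def c_def field_simps power2_eq_square)
    have nl: "real n * l\<^sup>2 * V = L"
      using elim \<open>V > 0\<close> t(2) by (simp add: l_def L_def c_def field_simps power2_eq_square)
    have "L \<ge> 0" using elim \<open>c > 0\<close> by (simp add: L_def)
    have "real n * (exp L * l ^ 3 * M) \<le> 1"
      using elim(1) by (simp add: e_def l_def L_def t_def mult_ac)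
    show ?case
    proof
      fix P assume P: "P \<in> Q"
      interpret prob_space P using P by (rule Q_prob_space)
      note [measurable] = block_measurable[OF P]
      have one: "prob {\<omega> \<in> space P. L \<le> l' * block 0 n \<omega>} \<le> 2 * ln (real n) powr (- c)"
        if "\<bar>l'\<bar> = l" for l'
      proof -
        have "l'\<^sup>2 = l\<^sup>2" using that by (metis power2_abs)
        have "prob {\<omega> \<in> space P. L \<le> l' * block 0 n \<omega>}
            \<le> exp (real n * l'\<^sup>2 * V / 2) * (1 + real n * (exp L * \<bar>l'\<bar> ^ 3 * M)) / exp L"
          unfolding M_def by (rule one_sided_tail[OF V \<open>L \<ge> 0\<close> P])
        also have "\<dots> \<le> exp (L / 2) * 2 / exp L"
          using \<open>real n * (exp L * l ^ 3 * M) \<le> 1\<close> unfolding that \<open>l'\<^sup>2 = l\<^sup>2\<close> nl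
          by (intro divide_right_mono mult_left_mono) auto
        also have "\<dots> = 2 * exp (L / 2 - L)"
          by (simp only: exp_diff) simp
        also have "L / 2 - L = - c * ln (ln (real n))"
          by (simp add: L_def)
        also have "exp \<dots> = ln (real n) powr (- c)"
          using elim by (auto simp: powr_def)
        finally show ?thesis .
      qed
      have "prob {\<omega> \<in> space P. t \<le> \<bar>block 0 n \<omega>\<bar>}
          \<le> prob ({\<omega> \<in> space P. L \<le> l * block 0 n \<omega>} \<union> {\<omega> \<in> space P. L \<le> (- l) * block 0 n \<omega>})"
      proof (rule finite_measure_mono)
        have "L \<le> l * x \<or> L \<le> (- l) * x" if "t \<le> \<bar>x\<bar>" for x
        proof -
          have "L = l * t" using tl by (simp add: mult.commute)
          also have "\<dots> \<le> l * \<bar>x\<bar>" using that \<open>l > 0\<close> by simp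
          finally have "L \<le> l * \<bar>x\<bar>" .
          then show ?thesis by (cases "x \<ge> 0") simp_all
        qed
        then show "{\<omega> \<in> space P. t \<le> \<bar>block 0 n \<omega>\<bar>}
            \<subseteq> {\<omega> \<in> space P. L \<le> l * block 0 n \<omega>} \<union> {\<omega> \<in> space P. L \<le> (- l) * block 0 n \<omega>}"
          by blast
      qed measurable
      also have "\<dots> \<le> prob {\<omega> \<in> space P. L \<le> l * block 0 n \<omega>} + prob {\<omega> \<in> space P. L \<le> (- l) * block 0 n \<omega>}"
        by (intro measure_Un_le) measurable
      also have "\<dots> \<le> 4 * ln (real n) powr (- c)"
        using one[of l] one[of "- l"] \<open>l > 0\<close> by simp
      finally show "prob {\<omega> \<in> space P. r * lil_scale n \<le> \<bar>block 0 n \<omega>\<bar>} \<le> 4 * ln (real n) powr (- (r\<^sup>2 / V))"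
        by (simp add: t_def c_def)
    qed
  qed
qed

text \<open>
  Room between \<open>\<sigma>\<close> and \<open>s\<close> is used three times: a variance bound \<open>\<tau>\<^sup>2 > 0\<close>, which also covers
  \<open>\<sigma> = 0\<close>, a tail level \<open>r > \<tau>\<close> to make the exponent \<open>r\<^sup>2 / \<tau>\<^sup>2\<close> exceed \<open>1\<close>, and \<open>s > r\<close>
  for the fluctuations within blocks.
\<close>

lemma AE_eventually_le_lil_scale:
  assumes V: "upper_expectation Q (\<lambda>\<omega>. (X 1 \<omega>)\<^sup>2) = \<sigma>\<^sup>2" and "\<sigma> \<ge> 0" "\<sigma> < s" and P: "P \<in> Q"
  shows "AE \<omega> in P. \<forall>\<^sub>F n in sequentially. \<bar>block 0 n \<omega>\<bar> \<le> s * lil_scale n"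
proof -
  interpret prob_space P using P by (rule Q_prob_space)
  obtain \<tau> where \<tau>: "\<sigma> < \<tau>" "\<tau> < s" using dense[OF \<open>\<sigma> < s\<close>] by blast
  obtain r where r: "\<tau> < r" "r < s" using dense[OF \<open>\<tau> < s\<close>] by blast
  note ord = \<tau> r
  have "\<tau> > 0" "r > 0" using ord \<open>\<sigma> \<ge> 0\<close> by auto
  have "\<tau>\<^sup>2 < r\<^sup>2" "\<sigma>\<^sup>2 \<le> \<tau>\<^sup>2"
    using ord \<open>\<sigma> \<ge> 0\<close> \<open>\<tau> > 0\<close> by (auto intro!: power_strict_mono power_mono)
  show ?thesis
  proof (rule eventually_le_lil_scale)
    show "block 0 n \<in> borel_measurable P" for n
      using P by (rule block_measurable)
    have powH: "(\<lambda>\<omega>. block k m \<omega> ^ (2 * q)) \<in> H" for k m q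
      by (intro comp_in_H[OF C_lLip_power] block_in_H)
    show "integrable P (\<lambda>\<omega>. (block 0 (k + m) \<omega> - block 0 k \<omega>) ^ (2 * q))" for k m q
      unfolding block_diff using powH P by (rule H_integrable)
    show "\<exists>C. \<forall>k m. (\<integral>\<omega>. (block 0 (k + m) \<omega> - block 0 k \<omega>) ^ (2 * q) \<partial>P) \<le> C * real m ^ q" for q
      unfolding block_diff
      using even_moment_bound[of q] integral_le_upper_expectation[OF powH P] by (meson order_trans)
    have "\<forall>\<^sub>F n in sequentially. \<forall>P\<in>Q. measure P {\<omega> \<in> space P. r * lil_scale n \<le> \<bar>block 0 n \<omega>\<bar>}
        \<le> 4 * ln (real n) powr (- (r\<^sup>2 / \<tau>\<^sup>2))"
      using \<open>\<tau> > 0\<close> \<open>r > 0\<close> \<open>\<sigma>\<^sup>2 \<le> \<tau>\<^sup>2\<close> V by (intro gaussian_tail) auto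
    then show "\<forall>\<^sub>F n in sequentially. prob {\<omega> \<in> space P. r * lil_scale n \<le> \<bar>block 0 n \<omega>\<bar>}
        \<le> 4 * ln (real n) powr (- (r\<^sup>2 / \<tau>\<^sup>2))"
      using P by (auto elim: eventually_mono)
    show "r\<^sup>2 / \<tau>\<^sup>2 > 1" using \<open>\<tau>\<^sup>2 < r\<^sup>2\<close> \<open>\<tau> > 0\<close> by simp
  qed (use ord \<open>r > 0\<close> in auto)
qed

end

section \<open>The law of the iterated logarithm\<close>

lemma centred_if_upper_eq_lower_eq_0:
  assumes "sublinear_expectation_setting F Q H" "Y \<in> H" "P \<in> Q"
    and "upper_expectation Q Y = 0" "lower_expectation Q Y = 0"
  shows "integral\<^sup>L P Y = 0"
proof -
  interpret sublinear_expectation_setting F Q H by fact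
  have "(\<lambda>x. - x) \<in> C_lLip"
    by (rule C_lLip_derivI[where f' = "\<lambda>_. - 1" and C = 1 and m = 0])
       (auto intro!: derivative_eq_intros)
  then have "(\<lambda>\<omega>. - Y \<omega>) \<in> H" using assms(2) by (rule comp_in_H)
  from integral_le_upper_expectation[OF this \<open>P \<in> Q\<close>] have "- integral\<^sup>L P Y \<le> 0"
    using assms(5) by (simp add: lower_expectation_eq)
  moreover have "integral\<^sup>L P Y \<le> 0"
    using integral_le_upper_expectation[OF assms(2,3)] assms(4) by simp
  ultimately show ?thesis by simp
qed

theorem theorem11:
  fixes F :: "'a measure" and Q :: "'a measure set" and H :: "('a \<Rightarrow> real) set"
    and X :: "nat \<Rightarrow> 'a \<Rightarrow> real" and S :: "nat \<Rightarrow> 'a \<Rightarrow> real" and a :: "nat \<Rightarrow> real"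
    and \<sigma>_up \<sigma>_low :: real
  assumes "sublinear_expectation_setting F Q H"
    and "\<And>i. i \<ge> 1 \<Longrightarrow> X i \<in> H"
    and "convolutionary Q X"
    and "\<And>i j. i \<ge> 1 \<Longrightarrow> j \<ge> 1 \<Longrightarrow> identically_distributed Q (X i) (X j)"
    and "upper_expectation Q (X 1) = 0" and "lower_expectation Q (X 1) = 0"
    and "\<sigma>_up \<ge> 0" and "\<sigma>_low \<ge> 0"
    and "upper_expectation Q (\<lambda>\<omega>. (X 1 \<omega>)\<^sup>2) = \<sigma>_up\<^sup>2"
    and "lower_expectation Q (\<lambda>\<omega>. (X 1 \<omega>)\<^sup>2) = \<sigma>_low\<^sup>2"
    and "\<And>n \<omega>. S n \<omega> = (\<Sum>i=1..n. X i \<omega>)"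
    and "\<And>n. n \<ge> 3 \<Longrightarrow> a n = sqrt (2 * real n * ln (ln (real n)))"
  shows "lower_capacity Q {\<omega> \<in> space F.
      ereal (- \<sigma>_up) \<le> liminf (\<lambda>n. ereal (S n \<omega> / a n)) \<and>
      liminf (\<lambda>n. ereal (S n \<omega> / a n)) \<le> limsup (\<lambda>n. ereal (S n \<omega> / a n)) \<and>
      limsup (\<lambda>n. ereal (S n \<omega> / a n)) \<le> ereal \<sigma>_up} = 1"
proof -
  interpret centred_convolutionary_sequence F Q H X
    using assms(1-6) by (auto simp: centred_convolutionary_sequence_def
        centred_convolutionary_sequence_axioms_def intro: centred_if_upper_eq_lower_eq_0)
  have S_eq: "S n \<omega> = block 0 n \<omega>" for n \<omega>
    by (simp add: assms(11) block_def)
  have a_eq: "a n = lil_scale n" if "n \<ge> 3" for n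
    using assms(12)[OF that] by (simp add: lil_scale_def)
  let ?G = "\<lambda>\<omega>. ereal (- \<sigma>_up) \<le> liminf (\<lambda>n. ereal (S n \<omega> / a n)) \<and>
      liminf (\<lambda>n. ereal (S n \<omega> / a n)) \<le> limsup (\<lambda>n. ereal (S n \<omega> / a n)) \<and>
      limsup (\<lambda>n. ereal (S n \<omega> / a n)) \<le> ereal \<sigma>_up"
  have "measure P {\<omega> \<in> space F. ?G \<omega>} = 1" if P: "P \<in> Q" for P
  proof -
    interpret prob_space P using P by (rule Q_prob_space)
    have [measurable]: "S n \<in> borel_measurable P" for n
      using block_measurable[OF P, of 0 n] by (simp add: S_eq[abs_def])
    have lil_scale_pos: "\<forall>\<^sub>F n in sequentially. 0 < lil_scale n"
      unfolding lil_scale_def by real_asymp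
    have "AE \<omega> in P. \<forall>i::nat. \<forall>\<^sub>F n in sequentially. \<bar>S n \<omega>\<bar> \<le> (\<sigma>_up + 1 / real (Suc i)) * lil_scale n"
      unfolding AE_all_countable S_eq
      using assms(7,9) P by (intro allI AE_eventually_le_lil_scale) auto
    then have "AE \<omega> in P. ?G \<omega>"
    proof eventually_elim
      case (elim \<omega>)
      have bounds: "ereal (- s) \<le> liminf (\<lambda>n. ereal (S n \<omega> / a n)) \<and>
          limsup (\<lambda>n. ereal (S n \<omega> / a n)) \<le> ereal s" if s: "s = \<sigma>_up + 1 / real (Suc i)" for s i
      proof -
        have bd: "\<forall>\<^sub>F n in sequentially. \<bar>S n \<omega> / a n\<bar> \<le> s"
          using elim[rule_format, of i, folded s] lil_scale_pos eventually_ge_at_top[of 3]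
        proof eventually_elim
          case (elim n)
          then show ?case by (simp add: a_eq divide_le_eq)
        qed
        have abs_le: "ereal (- s) \<le> ereal y" "ereal y \<le> ereal s" if "\<bar>y\<bar> \<le> s" for y
          using that by auto
        have "\<forall>\<^sub>F n in sequentially. ereal (- s) \<le> ereal (S n \<omega> / a n)"
          using bd by (rule eventually_mono) (rule abs_le)
        moreover have "\<forall>\<^sub>F n in sequentially. ereal (S n \<omega> / a n) \<le> ereal s"
          using bd by (rule eventually_mono) (rule abs_le)
        ultimately show ?thesis
          by (auto intro: Liminf_bounded Limsup_bounded)
      qed
      have "(\<lambda>i. \<sigma>_up + 1 / real (Suc i)) \<longlonglongrightarrow> \<sigma>_up"
        "(\<lambda>i. - (\<sigma>_up + 1 / real (Suc i))) \<longlonglongrightarrow> - \<sigma>_up"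
        by real_asymp+
      note lim = this[THEN tendsto_ereal]
      have "ereal (- \<sigma>_up) \<le> liminf (\<lambda>n. ereal (S n \<omega> / a n))"
        using lim(2) by (rule LIMSEQ_le_const2) (use bounds in blast)
      moreover have "limsup (\<lambda>n. ereal (S n \<omega> / a n)) \<le> ereal \<sigma>_up"
        using lim(1) by (rule LIMSEQ_le_const) (use bounds in blast)
      ultimately show ?case
        by (simp add: Liminf_le_Limsup)
    qed
    moreover have "{\<omega> \<in> space P. ?G \<omega>} \<in> events" by measurable
    ultimately have "prob {\<omega> \<in> space P. ?G \<omega>} = 1"
      by (subst prob_Collect_eq_1) auto
    then show ?thesis
      using sets_eq_imp_space_eq[OF Q_sets[OF P]] by simp
  qed
  then show ?thesis
    unfolding lower_capacity_def using Q_nonempty by simp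
qed

end
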